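(* Let $n\geq 1$ be a fixed integer and let $\mathcal{C}_n$ be the class of all finite $n$-colorable graphs. Every $\mathbf{X}\in\mathcal{C}_n$ has a finite Ramsey degree in $\mathcal{C}_n$ equal to $\tau(\mathbf{X})$. That is, $\tau(\mathbf{X})$ is the least integer $t$ such that for every $\mathbf{Y}\in\mathcal{C}_n$ and every $k\in\mathbb{N}$ there exists $\mathbf{Z}\in\mathcal{C}_n$ with $\mathbf{Z}\to(\mathbf{Y})^{\mathbf{X}}_{k,t}$.
   Context: Graphs are simple and loopless, viewed as structures $(X,E)$ with $E$ an irreflexive symmetric binary relation. $[n]=\{1,\dots,n\}$. $\mathcal{M}^<_n$ is the class of finite structures $(X,E,<,\lambda)$ where $(X,E)$ is a finite graph, $<$ a linear ordering of $X$, and $\lambda:X\to[n]$ a map with $\lambda(x)\neq\lambda(y)$ whenever $x,y$ are adjacent, which is moreover monotone: $x<y$ implies $\lambda(x)\leq\lambda(y)$. For $\mathbf{X}=(X,E^{\mathbf X})\in\mathcal{C}_n$, an extension of $\mathbf{X}$ in $\mathcal{M}^<_n$ is a structure $(X,E^{\mathbf X},<,\lambda)\in\mathcal{M}^<_n$; $\tau(\mathbf{X})$ is the number of pairwise non-isomorphic extensions of $\mathbf{X}$ in $\mathcal{M}^<_n$ (isomorphisms preserve edges, order and coloring). For graphs $\mathbf A,\mathbf B$, $\binom{\mathbf{B}}{\mathbf{A}}$ denotes the set of induced subgraphs of $\mathbf{B}$ isomorphic to $\mathbf{A}$. $\mathbf{Z}\to(\mathbf{Y})^{\mathbf{X}}_{k,t}$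 means: for every map $\alpha:\binom{\mathbf{Z}}{\mathbf{X}}\to[k]$ there is $\tilde{\mathbf{Y}}\in\binom{\mathbf{Z}}{\mathbf{Y}}$ such that $\alpha$ takes at most $t$ values on $\binom{\tilde{\mathbf{Y}}}{\mathbf{X}}$. *)

theory Defs
  imports "HOL-Library.FuncSet" "HOL-Library.Infinite_Typeclass"
begin

type_synonym 'v graph = "'v set \<times> 'v rel"

fun finite_graph :: "'v graph \<Rightarrow> bool" where
  "finite_graph (X, E) \<longleftrightarrow> finite X \<and> E \<subseteq> X \<times> X \<and> irrefl E \<and> sym E"

fun proper_coloring :: "nat \<Rightarrow> 'v graph \<Rightarrow> ('v \<Rightarrow> nat) \<Rightarrow> bool" where
  "proper_coloring n (X, E) c \<longleftrightarrow> c \<in> X \<rightarrow> {1..n} \<and> (\<forall>(x, y)\<in>E. c x \<noteq> c y)"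

text \<open>All graphs live on subsets of one type. If that type is infinite, every finite graph has an
  isomorphic copy in it, so the set below represents the whole class up to isomorphism.\<close>

definition colorable_graphs :: "nat \<Rightarrow> 'v graph set" where
  "colorable_graphs n = {G. finite_graph G \<and> (\<exists>c. proper_coloring n G c)}"

fun graph_iso :: "'v graph \<Rightarrow> 'w graph \<Rightarrow> bool" where
  "graph_iso (X, E) (Y, F) \<longleftrightarrow>
     (\<exists>f. bij_betw f X Y \<and> (\<forall>x\<in>X. \<forall>y\<in>X. (x, y) \<in> E \<longleftrightarrow> (f x, f y) \<in> F))"

fun induced_subgraphs :: "'v graph \<Rightarrow> 'v graph set" where
  "induced_subgraphs (X, E) = {(S, E \<inter> S \<times> S) | S. S \<subseteq> X}"

definition copies :: "'v graph \<Rightarrow> 'w graph \<Rightarrow> 'v graph set" where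
  "copies B A = {H \<in> induced_subgraphs B. graph_iso H A}"

definition arrows :: "'v graph \<Rightarrow> 'v graph \<Rightarrow> 'v graph \<Rightarrow> nat \<Rightarrow> nat \<Rightarrow> bool" where
  "arrows Z Y X k t \<longleftrightarrow>
     (\<forall>\<alpha> \<in> copies Z X \<rightarrow> {1..k}. \<exists>Y' \<in> copies Z Y. card (\<alpha> ` copies Y' X) \<le> t)"

definition ramsey_bound :: "'v graph set \<Rightarrow> 'v graph \<Rightarrow> nat \<Rightarrow> bool" where
  "ramsey_bound \<C> X t \<longleftrightarrow> (\<forall>Y\<in>\<C>. \<forall>k. \<exists>Z\<in>\<C>. arrows Z Y X k t)"

definition has_ramsey_degree :: "'v graph set \<Rightarrow> 'v graph \<Rightarrow> nat \<Rightarrow> bool" where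
  "has_ramsey_degree \<C> X t \<longleftrightarrow>
     ramsey_bound \<C> X t \<and> (\<forall>t'. ramsey_bound \<C> X t' \<longrightarrow> t \<le> t')"

type_synonym 'v ocgraph = "'v set \<times> 'v rel \<times> 'v rel \<times> ('v \<Rightarrow> nat)"

text \<open>Colourings are taken extensional, so that they are determined by their values on the
  vertices and each graph has only finitely many extensions.\<close>

definition monotone_ocgraphs :: "nat \<Rightarrow> 'v ocgraph set" where
  "monotone_ocgraphs n =
     {(X, E, R, c). finite_graph (X, E)
        \<and> R \<subseteq> X \<times> X \<and> strict_linear_order_on X R
        \<and> c \<in> extensional X \<and> proper_coloring n (X, E) c
        \<and> (\<forall>(x, y)\<in>R. c x \<le> c y)}"

fun ocgraph_iso :: "'v ocgraph \<Rightarrow> 'w ocgraph \<Rightarrow> bool" where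
  "ocgraph_iso (X, E, R, c) (Y, F, S, d) \<longleftrightarrow>
     (\<exists>f. bij_betw f X Y
        \<and> (\<forall>x\<in>X. \<forall>y\<in>X. (x, y) \<in> E \<longleftrightarrow> (f x, f y) \<in> F)
        \<and> (\<forall>x\<in>X. \<forall>y\<in>X. (x, y) \<in> R \<longleftrightarrow> (f x, f y) \<in> S)
        \<and> (\<forall>x\<in>X. c x = d (f x)))"

fun extensions :: "nat \<Rightarrow> 'v graph \<Rightarrow> 'v ocgraph set" where
  "extensions n (X, E) = {(X, E, R, c) | R c. (X, E, R, c) \<in> monotone_ocgraphs n}"

definition iso_rel :: "'v ocgraph set \<Rightarrow> 'v ocgraph rel" where
  "iso_rel \<A> = {(A, B). A \<in> \<A> \<and> B \<in> \<A> \<and> ocgraph_iso A B}"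

definition num_extensions :: "nat \<Rightarrow> 'v graph \<Rightarrow> nat" where
  "num_extensions n X = card (extensions n X // iso_rel (extensions n X))"

lemma ocgraph_iso_refl: "ocgraph_iso A A"
  by (cases A) (auto intro!: exI[of _ id])

lemma ocgraph_iso_sym:
  assumes "ocgraph_iso A B"
  shows "ocgraph_iso B A"
proof -
  obtain X E R c where A: "A = (X, E, R, c)" by (cases A)
  obtain Y F S d where B: "B = (Y, F, S, d)" by (cases B)
  obtain f where f: "bij_betw f X Y"
    "\<And>x y. x \<in> X \<Longrightarrow> y \<in> X \<Longrightarrow> (x, y) \<in> E \<longleftrightarrow> (f x, f y) \<in> F"
    "\<And>x y. x \<in> X \<Longrightarrow> y \<in> X \<Longrightarrow> (x, y) \<in> R \<longleftrightarrow> (f x, f y) \<in> S"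
    "\<And>x. x \<in> X \<Longrightarrow> c x = d (f x)"
    using assms unfolding A B by auto
  let ?g = "inv_into X f"
  have g: "?g y \<in> X" "f (?g y) = y" if "y \<in> Y" for y
    using f(1) that by (auto simp: bij_betw_def inv_into_into f_inv_into_f)
  show ?thesis unfolding A B
    using bij_betw_inv_into[OF f(1)] f(2-4) g
    by (auto intro!: exI[of _ ?g])
qed

lemma ocgraph_iso_trans:
  assumes "ocgraph_iso A B" "ocgraph_iso B C"
  shows "ocgraph_iso A C"
proof -
  obtain X E R c where A: "A = (X, E, R, c)" by (cases A)
  obtain Y F S d where B: "B = (Y, F, S, d)" by (cases B)
  obtain Z G T e where C: "C = (Z, G, T, e)" by (cases C)
  obtain f where f: "bij_betw f X Y"
    "\<And>x y. x \<in> X \<Longrightarrow> y \<in> X \<Longrightarrow> (x, y) \<in> E \<longleftrightarrow> (f x, f y) \<in> F"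
    "\<And>x y. x \<in> X \<Longrightarrow> y \<in> X \<Longrightarrow> (x, y) \<in> R \<longleftrightarrow> (f x, f y) \<in> S"
    "\<And>x. x \<in> X \<Longrightarrow> c x = d (f x)"
    using assms(1) unfolding A B by auto
  obtain g where g: "bij_betw g Y Z"
    "\<And>x y. x \<in> Y \<Longrightarrow> y \<in> Y \<Longrightarrow> (x, y) \<in> F \<longleftrightarrow> (g x, g y) \<in> G"
    "\<And>x y. x \<in> Y \<Longrightarrow> y \<in> Y \<Longrightarrow> (x, y) \<in> S \<longleftrightarrow> (g x, g y) \<in> T"
    "\<And>x. x \<in> Y \<Longrightarrow> d x = e (g x)"
    using assms(2) unfolding B C by auto
  have fY: "f x \<in> Y" if "x \<in> X" for x using f(1) that by (auto simp: bij_betw_def)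
  show ?thesis unfolding A C
    using bij_betw_trans[OF f(1) g(1)] f(2-4) g(2-4) fY
    by (auto intro!: exI[of _ "g \<circ> f"])
qed

lemma equiv_iso_rel: "equiv \<A> (iso_rel \<A>)"
  unfolding iso_rel_def
  by (intro equivI refl_onI symI transI)
    (auto intro: ocgraph_iso_refl ocgraph_iso_sym ocgraph_iso_trans)

lemma finite_extensions:
  assumes "finite_graph (X, E)"
  shows "finite (extensions n (X, E))"
proof (rule finite_subset)
  show "extensions n (X, E) \<subseteq> {X} \<times> {E} \<times> Pow (X \<times> X) \<times> (X \<rightarrow>\<^sub>E {1..n})"
    by (auto simp: monotone_ocgraphs_def PiE_def)
  show "finite ({X} \<times> {E} \<times> Pow (X \<times> X) \<times> (X \<rightarrow>\<^sub>E {1..n}))"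
    using assms by (auto intro!: finite_PiE)
qed

end

theory Submission
  imports Defs "HOL-Library.Ramsey" "HOL-Library.Countable" "HOL-Library.Product_Lexorder"
begin

text \<open>The upper bound rests on a canonical Ramsey theorem proved by the partite construction of
  Nesetril and Roedl: placing a copy of \<open>Y\<close> on every set of positions of the right size and
  then amplifying, one pattern of parts at a time, by means of the Hales--Jewett theorem makes the
  colour of a copy of \<open>X\<close> depend only on its pattern; Ramsey's theorem on the positions then
  removes the dependence on the positions. What is left is the isomorphism type of the
  extension that \<open>X\<close> inherits from a fixed monotone extension of \<open>Y\<close>.

  For the lower bound, colour each copy of \<open>X\<close> in \<open>Z\<close> by the type that it inherits from a
  monotone extension of \<open>Z\<close>. The canonical theorem for pairs yields a graph \<open>Y\<close> all of whose
  extensions contain every extension of \<open>X\<close>, so that no copy of \<open>Y\<close> misses a colour.\<close>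

section \<open>The theorems of Hales--Jewett and Ramsey for finite sets of colours\<close>

text \<open>The graph \<open>Z\<close> must stay \<open>n\<close>-colourable, and this dictates the
  parts: a part is a pair of a position and a colour, and edges may join only parts of distinct
  colours. A graph that is partite over this base is \<open>n\<close>-coloured by its colour
  coordinate, however often it is amplified. Positions make the increasing placement of a set of
  vertices well defined, so that on given positions all subsets of one type show the same pattern.
  The customary amplification applies Hales--Jewett to the parts of one pattern and then glues a
  copy of the whole system to each line. Here the power is taken over all parts at once, with a
  letter \<open>None\<close> where a vertex outside the pattern has no counterpart in a transversal,
  so that a line embeds the whole system directly. For the lower bound the obstacle is that the
  colouring and the order of \<open>Z\<close> bear no relation to those of the witness. Both are
  encoded in one finite colouring of pairs, and it is enough to make it uniform on pairs inside the
  colour classes: between classes the order of a monotone structure is forced by the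
  colours.\<close>

definition words :: "nat \<Rightarrow> nat \<Rightarrow> nat list set" where
  "words N r = {w. length w = N \<and> set w \<subseteq> {..<r}}"

text \<open>A line is encoded by its root: \<open>None\<close> marks the active coordinates, of
  which there is at least one, and \<open>Some a\<close> a coordinate fixed to the letter
  \<open>a\<close>.\<close>

definition comb_lines :: "nat \<Rightarrow> nat \<Rightarrow> nat option list set" where
  "comb_lines N r = {L. length L = N \<and> None \<in> set L \<and> set L \<subseteq> insert None (Some ` {..<r})}"

definition inst :: "nat option list \<Rightarrow> nat \<Rightarrow> nat list" where
  "inst L a = map (case_option a id) L"

lemma finite_words: "finite (words N r)"
  using finite_lists_length_eq[of "{..<r}" N] by (simp add: words_def conj_commute)

lemma inst_append: "inst (L @ M) a = inst L a @ inst M a"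
  by (simp add: inst_def)

lemma inst_map_Some: "inst (map Some w) a = w"
  by (simp add: inst_def comp_def)

lemma inst_in_words:
  assumes "L \<in> comb_lines N r" "a < r"
  shows "inst L a \<in> words N r"
  using assms by (fastforce simp: comb_lines_def words_def inst_def split: option.splits)

lemma comb_lines_append:
  assumes "L \<in> comb_lines N r" "M \<in> comb_lines N' r"
  shows "L @ M \<in> comb_lines (N + N') r"
  using assms by (auto simp: comb_lines_def)

lemma comb_lines_append_word:
  assumes "L \<in> comb_lines N r" "w \<in> words N' r"
  shows "L @ map Some w \<in> comb_lines (N + N') r"
  using assms by (auto simp: comb_lines_def words_def)

lemma word_append_comb_lines:
  assumes "L \<in> comb_lines N r" "w \<in> words N' r"
  shows "map Some w @ L \<in> comb_lines (N' + N) r"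
  using assms by (auto simp: comb_lines_def words_def)

lemma comb_lines_mono: "r \<le> s \<Longrightarrow> comb_lines N r \<subseteq> comb_lines N s"
  unfolding comb_lines_def by fastforce

definition hj_property :: "nat \<Rightarrow> nat \<Rightarrow> nat \<Rightarrow> bool" where
  "hj_property r k N \<longleftrightarrow> (\<forall>\<chi> :: nat list \<Rightarrow> nat. (\<forall>w. \<chi> w < k) \<longrightarrow>
     (\<exists>L\<in>comb_lines N r. \<exists>i. \<forall>a<r. \<chi> (inst L a) = i))"

text \<open>The focusing argument colours by functions on words, and the partite step by an
  arbitrary \<open>K\<close>; a numbering of \<open>K\<close> reduces both to initial segments of
  the naturals.\<close>

lemma hj_property_finite:
  assumes hj: "\<And>k. \<exists>N. hj_property r k N" and "finite (K :: 'c set)"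
  shows "\<exists>N. \<forall>\<chi>. (\<forall>w. \<chi> w \<in> K) \<longrightarrow> (\<exists>L\<in>comb_lines N r. \<exists>i. \<forall>a<r. \<chi> (inst L a) = i)"
proof -
  obtain h where h: "bij_betw h K {0..<card K}"
    using ex_bij_betw_finite_nat[OF assms(2)] by blast
  obtain N where N: "hj_property r (card K) N" using hj by blast
  have "\<exists>L\<in>comb_lines N r. \<exists>i. \<forall>a<r. \<chi> (inst L a) = i" if \<chi>: "\<forall>w. \<chi> w \<in> K" for \<chi> :: "nat list \<Rightarrow> 'c"
  proof -
    have "\<forall>w. h (\<chi> w) < card K" using \<chi> h by (auto simp: bij_betw_def)
    then obtain L i where L: "L \<in> comb_lines N r" "\<forall>a<r. h (\<chi> (inst L a)) = i"
      using N[unfolded hj_property_def, rule_format, of "\<lambda>w. h (\<chi> w)"] by blast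
    have "\<forall>a<r. \<chi> (inst L a) = inv_into K h i"
      using L(2) h \<chi> by (metis bij_betw_def inv_into_f_f)
    then show ?thesis using L(1) by blast
  qed
  then show ?thesis by blast
qed

text \<open>The dichotomy of colour focusing: a monochromatic line, or \<open>j\<close> lines that
  share their point at the new letter \<open>r\<close> and are each monochromatic on the letters
  below \<open>r\<close>. Indexing these lines by their colours makes the colours distinct.\<close>

definition mono_or_focused :: "nat \<Rightarrow> nat \<Rightarrow> nat \<Rightarrow> nat \<Rightarrow> (nat list \<Rightarrow> nat) \<Rightarrow> bool" where
  "mono_or_focused r k j N \<chi> \<longleftrightarrow>
     (\<exists>L\<in>comb_lines N (Suc r). \<exists>i. \<forall>a<Suc r. \<chi> (inst L a) = i) \<or>
     (\<exists>I f. I \<subseteq> {..<k} \<and> card I = j \<and> f \<in> words N (Suc r) \<and>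
        (\<forall>i\<in>I. \<exists>L\<in>comb_lines N (Suc r). inst L r = f \<and> (\<forall>a<r. \<chi> (inst L a) = i)))"

text \<open>Each step prepends a block of \<open>M\<close> coordinates. Hales--Jewett for
  \<open>r\<close> letters, with the colourings of all suffixes of length \<open>N\<close> as
  colours, gives a line \<open>L\<close> in this block along which the letters below
  \<open>r\<close> are indistinguishable. The focused lines of the suffix can then move together
  with \<open>L\<close>.\<close>

lemma hj_focusing:
  assumes hj: "\<And>k. \<exists>N. hj_property r k N" and "r \<ge> 1"
  shows "\<exists>N. \<forall>\<chi>. (\<forall>w. \<chi> w < k) \<longrightarrow> mono_or_focused r k j N \<chi>"
proof (induction j)
  case 0
  have "[] \<in> words 0 (Suc r)" by (simp add: words_def)
  then have "mono_or_focused r k 0 0 \<chi>" for \<chi>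
    unfolding mono_or_focused_def by (intro disjI2 exI[of _ "{}"] exI[of _ "[]"]) simp
  then show ?case by blast
next
  case (Suc j)
  then obtain N where N: "\<forall>\<chi>. (\<forall>w. \<chi> w < k) \<longrightarrow> mono_or_focused r k j N \<chi>" ..
  let ?W = "words N (Suc r)"
  have "finite (?W \<rightarrow>\<^sub>E {..<k})" by (intro finite_PiE finite_words) auto
  from hj_property_finite[OF hj this] obtain M where M:
    "\<forall>\<xi>. (\<forall>w. \<xi> w \<in> ?W \<rightarrow>\<^sub>E {..<k}) \<longrightarrow> (\<exists>L\<in>comb_lines M r. \<exists>i. \<forall>a<r. \<xi> (inst L a) = i)" ..
  show ?case
  proof (intro exI[of _ "M + N"] allI impI)
    fix \<chi> :: "nat list \<Rightarrow> nat"
    assume \<chi>: "\<forall>w. \<chi> w < k"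
    have "\<forall>u. (\<lambda>w\<in>?W. \<chi> (u @ w)) \<in> ?W \<rightarrow>\<^sub>E {..<k}" using \<chi> by auto
    from M[rule_format, of "\<lambda>u. \<lambda>w\<in>?W. \<chi> (u @ w)", OF this[rule_format]] obtain L g where L: "L \<in> comb_lines M r"
      and g: "\<And>a. a < r \<Longrightarrow> (\<lambda>w\<in>?W. \<chi> (inst L a @ w)) = g" by blast
    have L': "L \<in> comb_lines M (Suc r)" using L comb_lines_mono[of r "Suc r"] by auto
    \<comment> \<open>By \<open>r \<ge> 1\<close> the letter 0 is below \<open>r\<close> and can
      represent all such letters.\<close>
    have eq: "\<chi> (inst L a @ w) = \<chi> (inst L 0 @ w)" if "a < r" "w \<in> ?W" for a w
      using g[of a] g[of 0] that \<open>r \<ge> 1\<close> by (metis (no_types, lifting) gr0I not_less_zero restrict_apply')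
    have L0: "inst L 0 \<in> words M (Suc r)" using inst_in_words[OF L'] by auto
    have Lr: "inst L r \<in> words M (Suc r)" using inst_in_words[OF L'] by auto
    let ?\<chi> = "\<lambda>w. \<chi> (inst L 0 @ w)"
    have "\<forall>w. ?\<chi> w < k" using \<chi> by simp
    from N[rule_format, of ?\<chi>, OF this[rule_format]] have "mono_or_focused r k j N ?\<chi>" .
    then consider P i where "P \<in> comb_lines N (Suc r)" "\<forall>a<Suc r. \<chi> (inst L 0 @ inst P a) = i"
      | I f where "I \<subseteq> {..<k}" "card I = j" "f \<in> ?W"
        "\<forall>i\<in>I. \<exists>P\<in>comb_lines N (Suc r). inst P r = f \<and> (\<forall>a<r. \<chi> (inst L 0 @ inst P a) = i)"
      unfolding mono_or_focused_def by blast
    then show "mono_or_focused r k (Suc j) (M + N) \<chi>"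
    proof cases
      case P: 1
      have "map Some (inst L 0) @ P \<in> comb_lines (M + N) (Suc r)"
        by (rule word_append_comb_lines[OF P(1) L0])
      then show ?thesis using P(2) unfolding mono_or_focused_def
        by (intro disjI1 bexI[of _ "map Some (inst L 0) @ P"])
          (auto simp: inst_append inst_map_Some)
    next
      case 2
      note I = 2(1,2) and f = 2(3) and foc = 2(4)
      \<comment> \<open>The colour of the old focus decides. If a focused line already has it, that
        line is monochromatic including its last point; otherwise it is the colour of an additional
        line.\<close>
      let ?i = "\<chi> (inst L 0 @ f)"
      show ?thesis
      proof (cases "?i \<in> I")
        case True
        then obtain P where P: "P \<in> comb_lines N (Suc r)" "inst P r = f"
          "\<forall>a<r. \<chi> (inst L 0 @ inst P a) = ?i" using foc by blast
        have "map Some (inst L 0) @ P \<in> comb_lines (M + N) (Suc r)"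
          by (rule word_append_comb_lines[OF P(1) L0])
        moreover have "\<forall>a<Suc r. \<chi> (inst (map Some (inst L 0) @ P) a) = ?i"
          using P by (auto simp: inst_append inst_map_Some less_Suc_eq)
        ultimately show ?thesis unfolding mono_or_focused_def by blast
      next
        case False
        have 1: "insert ?i I \<subseteq> {..<k}" using I \<chi> by auto
        have 2: "card (insert ?i I) = Suc j" using False I finite_subset[OF I(1)] by auto
        have 3: "inst L r @ f \<in> words (M + N) (Suc r)" using Lr f by (auto simp: words_def)
        \<comment> \<open>The additional line is \<open>L\<close> with the old focus as fixed
          suffix; an old line \<open>P\<close> becomes \<open>L @ P\<close>, active in both blocks.
          All of them end in \<open>inst L r @ f\<close>.\<close>
        have 4: "\<exists>Q\<in>comb_lines (M + N) (Suc r). inst Q r = inst L r @ f \<and> (\<forall>a<r. \<chi> (inst Q a) = i)"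
          if i: "i \<in> insert ?i I" for i
        proof (cases "i = ?i")
          case True
          have "\<forall>a<r. \<chi> (inst (L @ map Some f) a) = i"
            unfolding inst_append inst_map_Some True using eq[OF _ f] by blast
          then show ?thesis using comb_lines_append_word[OF L' f]
            by (intro bexI[of _ "L @ map Some f"]) (simp_all only: inst_append inst_map_Some)
        next
          case False
          then obtain P where P: "P \<in> comb_lines N (Suc r)" "inst P r = f"
            "\<forall>a<r. \<chi> (inst L 0 @ inst P a) = i" using foc i by blast
          have "\<chi> (inst L a @ inst P a) = i" if "a < r" for a
            using eq[OF that inst_in_words[OF P(1) less_SucI[OF that]]] P(3)[rule_format, OF that]
            by (rule trans)
          then show ?thesis using comb_lines_append[OF L' P(1)] P(2)
            by (intro bexI[of _ "L @ P"]) (auto simp: inst_append)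
        qed
        show ?thesis unfolding mono_or_focused_def 
          by (intro disjI2 exI[of _ "insert ?i I"] exI[of _ "inst L r @ f"] conjI ballI 1 2 3 4)
      qed
    qed
  qed
qed

text \<open>With \<open>k\<close> colours there cannot be \<open>Suc k\<close> focused lines of
  distinct colours, so focusing must end in a monochromatic line. A single letter is treated apart,
  since focusing requires a letter below the new one.\<close>

lemma hales_jewett_nat: "\<exists>N. hj_property r k N"
proof (induction r arbitrary: k)
  case 0
  have "[None] \<in> comb_lines 1 0" by (simp add: comb_lines_def)
  then show ?case unfolding hj_property_def by auto
next
  case (Suc r)
  show ?case
  proof (cases "r = 0")
    case True
    have "[None] \<in> comb_lines 1 (Suc r)" by (simp add: comb_lines_def)
    then show ?thesis using True unfolding hj_property_def by (auto intro!: exI[of _ "1::nat"])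
  next
    case False
    then obtain N where N: "\<forall>\<chi>. (\<forall>w. \<chi> w < k) \<longrightarrow> mono_or_focused r k (Suc k) N \<chi>"
      using hj_focusing[OF Suc, of k "Suc k"] by auto
    have "\<not> (I \<subseteq> {..<k} \<and> card I = Suc k)" for I :: "nat set"
      using card_mono[of "{..<k}" I] by auto
    moreover have "mono_or_focused r k (Suc k) N \<chi>" if "\<forall>w. \<chi> w < k" for \<chi>
      using N that by simp
    ultimately have "hj_property (Suc r) k N" unfolding hj_property_def mono_or_focused_def by metis
    then show ?thesis by blast
  qed
qed

lemmas hales_jewett = hj_property_finite[OF hales_jewett_nat]

lemma ramsey_finite_colours:
  assumes "finite (K :: 'c set)"
  shows "\<exists>N::nat. \<forall>f. (\<forall>S. f S \<in> K) \<longrightarrow>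
    (\<exists>Q\<subseteq>{..<N}. card Q = b \<and> (\<exists>i. \<forall>S\<subseteq>Q. card S = a \<longrightarrow> f S = i))"
proof -
  obtain h where h: "bij_betw h K {0..<card K}"
    using ex_bij_betw_finite_nat[OF assms] by blast
  obtain N :: nat where N: "partn_lst {..<N} (replicate (card K) b) a" using ramsey_full by blast
  have "\<exists>Q\<subseteq>{..<N}. card Q = b \<and> (\<exists>i. \<forall>S\<subseteq>Q. card S = a \<longrightarrow> f S = i)"
    if f: "\<forall>S. f S \<in> K" for f :: "nat set \<Rightarrow> 'c"
  proof -
    have "(h \<circ> f) \<in> nsets {..<N} a \<rightarrow> {..<card K}" using f h by (auto simp: bij_betw_def)
    then obtain i Q where i: "i < card K" and Q: "Q \<in> nsets {..<N} b" "(h \<circ> f) ` nsets Q a \<subseteq> {i}"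
      using N unfolding partn_lst_def monochromatic_def by fastforce
    have "f S = inv_into K h i" if "S \<subseteq> Q" "card S = a" for S
    proof -
      have "finite S" using Q(1) that by (auto simp: nsets_def intro: finite_subset)
      then have "h (f S) = i" using Q that by (auto simp: nsets_def)
      then show ?thesis using f h by (metis bij_betw_def inv_into_f_f)
    qed
    then show ?thesis using Q(1) unfolding nsets_def by blast
  qed
  then show ?thesis by blast
qed

section \<open>The partite construction\<close>

text \<open>The part of a vertex is its first component, and \<open>D\<close> lists the pairs of
  parts that edges may join. Later \<open>D\<close> relates parts of distinct colours, which
  excludes loops and provides the \<open>n\<close>-colouring.\<close>

definition partite :: "'p set \<Rightarrow> 'p rel \<Rightarrow> ('p \<times> 'l) graph \<Rightarrow> bool" where
  "partite B D P \<longleftrightarrow> finite (fst P) \<and> fst ` fst P \<subseteq> B \<and> snd P \<subseteq> fst P \<times> fst P \<and> sym (snd P) \<and>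
     (\<forall>(u, v)\<in>snd P. (fst u, fst v) \<in> D)"

definition part_embedding ::
    "('p \<times> 'l) graph \<Rightarrow> ('p \<times> 'm) graph \<Rightarrow> ('p \<times> 'l \<Rightarrow> 'p \<times> 'm) \<Rightarrow> bool" where
  "part_embedding P P' \<phi> \<longleftrightarrow> \<phi> ` fst P \<subseteq> fst P' \<and> inj_on \<phi> (fst P) \<and> (\<forall>u\<in>fst P. fst (\<phi> u) = fst u) \<and>
     (\<forall>u\<in>fst P. \<forall>v\<in>fst P. (\<phi> u, \<phi> v) \<in> snd P' \<longleftrightarrow> (u, v) \<in> snd P)"

text \<open>The pattern \<open>A\<close> is a graph on the parts themselves, so that
  \<open>fst\<close> is an isomorphism from the subgraph induced on \<open>U\<close> to
  \<open>A\<close>.\<close>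

definition transversals :: "('p \<times> 'l) graph \<Rightarrow> 'p graph \<Rightarrow> ('p \<times> 'l) set set" where
  "transversals P A = {U. U \<subseteq> fst P \<and> bij_betw fst U (fst A) \<and>
     (\<forall>u\<in>U. \<forall>v\<in>U. (u, v) \<in> snd P \<longleftrightarrow> (fst u, fst v) \<in> snd A)}"

lemma part_embedding_id: "part_embedding P P id"
  by (simp add: part_embedding_def)

lemma part_embedding_comp:
  assumes "part_embedding P P' \<phi>" "part_embedding P' P'' \<psi>"
  shows "part_embedding P P'' (\<psi> \<circ> \<phi>)"
  using assms unfolding part_embedding_def
  by (auto simp: inj_on_def image_subset_iff)

lemma part_embedding_transversals:
  assumes e: "part_embedding P P' \<phi>" and U: "U \<in> transversals P A"
  shows "\<phi> ` U \<in> transversals P' A"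
proof -
  have UP: "u \<in> fst P" if "u \<in> U" for u using U that by (auto simp: transversals_def)
  have f: "fst (\<phi> u) = fst u" if "u \<in> U" for u using e UP[OF that] by (simp add: part_embedding_def)
  have "bij_betw fst (\<phi> ` U) (fst A)"
    using U f by (auto simp: transversals_def bij_betw_def inj_on_def image_image cong: image_cong)
  then show ?thesis using e U UP f by (auto simp: transversals_def part_embedding_def)
qed

section \<open>Powers of a partite graph and their combinatorial lines\<close>

definition adj :: "('p \<times> 'l) rel \<Rightarrow> 'p \<Rightarrow> 'p \<Rightarrow> 'l option \<Rightarrow> 'l option \<Rightarrow> bool" where
  "adj E p q x y \<longleftrightarrow> (\<exists>a b. x = Some a \<and> y = Some b \<and> ((p, a), (q, b)) \<in> E)"

lemma adj_simps [simp]: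
  "adj E p q (Some a) (Some b) \<longleftrightarrow> ((p, a), (q, b)) \<in> E"
  "\<not> adj E p q None y" "\<not> adj E p q x None"
  by (auto simp: adj_def)

text \<open>Adjacency in all coordinates over the edges of the pattern \<open>G\<close> and in some coordinate
  elsewhere: in both cases the coordinates that a line fixes to a transversal are neutral.\<close>

definition power_adj :: "('p \<times> 'l) rel \<Rightarrow> 'p rel \<Rightarrow> 'p \<Rightarrow> 'p \<Rightarrow> 'l option list \<Rightarrow> 'l option list \<Rightarrow> bool" where
  "power_adj E G p q xs ys \<longleftrightarrow>
     (if (p, q) \<in> G then \<forall>i<length xs. adj E p q (xs ! i) (ys ! i)
      else \<exists>i<length xs. adj E p q (xs ! i) (ys ! i))"

lemma power_adj_sym:
  assumes "sym E" "sym G" "length xs = length ys"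
  shows "power_adj E G p q xs ys \<longleftrightarrow> power_adj E G q p ys xs"
proof -
  have a: "adj E p q x y \<longleftrightarrow> adj E q p y x" for x y
    using \<open>sym E\<close> by (auto simp: adj_def dest: symD)
  have "(p, q) \<in> G \<longleftrightarrow> (q, p) \<in> G" using \<open>sym G\<close> by (auto dest: symD)
  then show ?thesis using assms(3)
    by (simp add: power_adj_def a)
qed

text \<open>Coordinate lists are coded by \<open>to_nat\<close> so that labels are again natural
  numbers and the construction can be iterated. A coordinate need not name a vertex of
  \<open>P\<close> in its part; such a coordinate is adjacent to nothing.\<close>

definition power_graph :: "nat \<Rightarrow> ('p \<times> nat) graph \<Rightarrow> 'p rel \<Rightarrow> ('p \<times> nat) graph" where
  "power_graph N P G =
     (let V = {(p, to_nat xs) | p xs. p \<in> fst ` fst P \<and> length xs = N \<and>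
                 set xs \<subseteq> insert None (Some ` snd ` fst P)}
      in (V, {((p, to_nat xs), (q, to_nat ys)) | p q xs ys.
                (p, to_nat xs) \<in> V \<and> (q, to_nat ys) \<in> V \<and> power_adj (snd P) G p q xs ys}))"

lemma power_graph_vertex:
  "(p, to_nat xs) \<in> fst (power_graph N P G) \<longleftrightarrow> p \<in> fst ` fst P \<and> length xs = N \<and>
      set xs \<subseteq> insert None (Some ` snd ` fst P)"
  by (auto simp: power_graph_def Let_def)

lemma power_graph_edge:
  "((p, to_nat xs), (q, to_nat ys)) \<in> snd (power_graph N P G) \<longleftrightarrow>
     (p, to_nat xs) \<in> fst (power_graph N P G) \<and> (q, to_nat ys) \<in> fst (power_graph N P G) \<and>
     power_adj (snd P) G p q xs ys"
  by (auto simp: power_graph_def Let_def)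

lemma power_graph_vertexE:
  assumes "u \<in> fst (power_graph N P G)"
  obtains p and xs :: "nat option list" where "u = (p, to_nat xs)" "length xs = N"
proof -
  have "\<exists>p xs. u = (p, to_nat (xs :: nat option list)) \<and> length xs = N"
    using assms unfolding power_graph_def Let_def fst_conv mem_Collect_eq by blast
  then show thesis using that by blast
qed

lemma power_graph_edge_vertices:
  "snd (power_graph N P G) \<subseteq> fst (power_graph N P G) \<times> fst (power_graph N P G)"
  by (auto simp: power_graph_def Let_def)

lemma power_graph_edgeE:
  assumes "(u, v) \<in> snd (power_graph N P G)"
  obtains p and xs :: "nat option list" and q and ys :: "nat option list"
  where "u = (p, to_nat xs)" "length xs = N" "v = (q, to_nat ys)" "length ys = N"
    "power_adj (snd P) G p q xs ys"
proof -
  have uv: "u \<in> fst (power_graph N P G)" "v \<in> fst (power_graph N P G)"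
    using assms power_graph_edge_vertices by blast+
  obtain p and xs :: "nat option list" where u: "u = (p, to_nat xs)" "length xs = N" using power_graph_vertexE[OF uv(1)] .
  obtain q and ys :: "nat option list" where v: "v = (q, to_nat ys)" "length ys = N" using power_graph_vertexE[OF uv(2)] .
  have "power_adj (snd P) G p q xs ys" using assms unfolding u(1) v(1) power_graph_edge by simp
  then show thesis by (rule that[OF u v])
qed

text \<open>An edge of the power has an edge of \<open>P\<close> between the same parts in some
  coordinate, hence respects \<open>D\<close>. Over the edges of \<open>G\<close> this needs a
  coordinate to exist, whence \<open>N > 0\<close>.\<close>

lemma partite_power_graph:
  assumes P: "partite B D P" and "sym G" "N > 0"
  shows "partite B D (power_graph N P G)"
proof -
  let ?P = "power_graph N P G"
  have fin: "finite (fst P)" using P by (simp add: partite_def)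
  have "fst ?P \<subseteq> fst ` fst P \<times> to_nat ` {xs. set xs \<subseteq> insert None (Some ` snd ` fst P) \<and> length xs = N}"
    by (auto simp: power_graph_def)
  moreover have "finite \<dots>"
    using fin by (intro finite_cartesian_product finite_imageI finite_lists_length_eq) auto
  ultimately have 1: "finite (fst ?P)" by (rule finite_subset)
  have 2: "fst ` fst ?P \<subseteq> B" using P by (auto simp: power_graph_def partite_def)
  have 3: "sym (snd ?P)"
  proof (rule symI)
    fix u v assume uv: "(u, v) \<in> snd ?P"
    obtain p xs q ys where u: "u = (p, to_nat xs)" "length xs = N"
      and v: "v = (q, to_nat ys)" "length ys = N" and uv': "power_adj (snd P) G p q xs ys"
      using power_graph_edgeE[OF uv] .
    have "power_adj (snd P) G p q xs ys \<longleftrightarrow> power_adj (snd P) G q p ys xs"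
      using P \<open>sym G\<close> u v by (intro power_adj_sym) (auto simp: partite_def)
    then show "(v, u) \<in> snd ?P" using uv uv' unfolding u(1) v(1) power_graph_edge by simp
  qed
  have 4: "(fst u, fst v) \<in> D" if uv: "(u, v) \<in> snd ?P" for u v
  proof -
    obtain p xs q ys where u: "u = (p, to_nat xs)" "length xs = N"
      and v: "v = (q, to_nat ys)" "length ys = N" and uv': "power_adj (snd P) G p q xs ys"
      using power_graph_edgeE[OF uv] .
    from uv' have "\<exists>x y. adj (snd P) p q x y"
      using u v \<open>N > 0\<close> by (auto simp: power_adj_def split: if_splits)
    then show ?thesis using P u v by (auto simp: adj_def partite_def)
  qed
  have 5: "\<forall>(u, v)\<in>snd ?P. (fst u, fst v) \<in> D" using 4 by auto
  show ?thesis unfolding partite_def by (intro conjI 1 2 3 5 power_graph_edge_vertices)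
qed

definition label :: "('p \<times> 'l) set \<Rightarrow> 'p \<Rightarrow> 'l" where
  "label U p = (THE l. (p, l) \<in> U)"

lemma label_transversal:
  assumes "U \<in> transversals P A"
  shows "p \<in> fst A \<Longrightarrow> (p, label U p) \<in> U" "(p, l) \<in> U \<Longrightarrow> p \<in> fst A \<and> label U p = l"
proof -
  have ex1: "\<exists>!l. (p, l) \<in> U" if "p \<in> fst A" for p
    using assms that by (force simp: transversals_def bij_betw_def inj_on_def)
  show "p \<in> fst A \<Longrightarrow> (p, label U p) \<in> U" unfolding label_def using theI'[OF ex1] .
  show "p \<in> fst A \<and> label U p = l" if "(p, l) \<in> U"
  proof
    show p: "p \<in> fst A" using assms that by (force simp: transversals_def bij_betw_def)
    show "label U p = l" unfolding label_def using the1_equality[OF ex1[OF p] that] .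
  qed
qed

text \<open>A line over the alphabet of \<open>A\<close>-transversals embeds the graph in its power: the active
  coordinates carry the vertex itself, a coordinate fixed to the transversal \<open>U\<close> carries the
  vertex of \<open>U\<close> in the same part, if there is one.\<close>

definition line_embedding ::
    "'p graph \<Rightarrow> (nat \<Rightarrow> ('p \<times> nat) set) \<Rightarrow> nat option list \<Rightarrow> 'p \<times> nat \<Rightarrow> 'p \<times> nat" where
  "line_embedding A U L = (\<lambda>(p, l). (p, to_nat (map (\<lambda>x. case x of None \<Rightarrow> Some l
     | Some a \<Rightarrow> if p \<in> fst A then Some (label (U a) p) else None) L)))"

text \<open>The points of the Hales--Jewett cube as vertex sets of the power: the letters of
  \<open>w\<close> select the transversal used in each coordinate.\<close>

definition word_transversal ::
    "'p graph \<Rightarrow> (nat \<Rightarrow> ('p \<times> nat) set) \<Rightarrow> nat list \<Rightarrow> ('p \<times> nat) set" where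
  "word_transversal A U w = (\<lambda>p. (p, to_nat (map (\<lambda>a. Some (label (U a) p)) w))) ` fst A"

text \<open>Writing the vertices of \<open>U a\<close> into the active coordinates amounts to
  instantiating the line at the letter \<open>a\<close>. This turns a monochromatic line into an
  embedding that gives all transversals one colour.\<close>

lemma line_embedding_transversal:
  assumes "U a \<in> transversals P A"
  shows "line_embedding A U L ` U a = word_transversal A U (inst L a)"
proof -
  have *: "U a = (\<lambda>p. (p, label (U a) p)) ` fst A"
    using label_transversal[OF assms] by force
  have "line_embedding A U L (p, label (U a) p) =
      (p, to_nat (map (\<lambda>b. Some (label (U b) p)) (inst L a)))" if "p \<in> fst A" for p
    using that by (auto simp: line_embedding_def inst_def split: option.splits)
  then show ?thesis
    by (subst *) (auto simp: word_transversal_def image_image cong: image_cong)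
qed

text \<open>At a coordinate fixed to \<open>U a\<close>, adjacency is adjacency in \<open>A\<close>,
  as \<open>U a\<close> induces \<open>A\<close>. So the active coordinates alone decide whether two
  images are adjacent, and a single one of them yields injectivity.\<close>

lemma part_embedding_line:
  assumes E: "snd P \<subseteq> fst P \<times> fst P" and U: "\<And>a. a < r \<Longrightarrow> U a \<in> transversals P A"
    and A: "snd A \<subseteq> fst A \<times> fst A" and L: "L \<in> comb_lines N r"
  shows "part_embedding P (power_graph N P (snd A)) (line_embedding A U L)"
proof -
  let ?f = "\<lambda>p l x. case x of None \<Rightarrow> Some l
     | Some a \<Rightarrow> if p \<in> fst A then Some (label (U a) p) else None"
  have le: "line_embedding A U L (p, l) = (p, to_nat (map (?f p l) L))" for p l
    by (simp add: line_embedding_def)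
  have NL: "None \<in> set L" "length L = N" using L by (auto simp: comb_lines_def)
  have lt: "a < r" if "Some a \<in> set L" for a using L that by (auto simp: comb_lines_def)
  have lab: "(p, label (U a) p) \<in> fst P" if "Some a \<in> set L" "p \<in> fst A" for a p
    using label_transversal(1)[OF U[OF lt[OF that(1)]] that(2)] U[OF lt[OF that(1)]]
    by (auto simp: transversals_def)
  have 1: "line_embedding A U L u \<in> fst (power_graph N P (snd A))" if "u \<in> fst P" for u
  proof -
    obtain p l where u: "u = (p, l)" by (cases u)
    have "?f p l x \<in> insert None (Some ` snd ` fst P)" if "x \<in> set L" for x
      using lab[of _ p] that \<open>u \<in> fst P\<close> u by (force split: option.splits)
    then show ?thesis unfolding u le power_graph_vertex using \<open>u \<in> fst P\<close> u NL by force
  qed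
  have 2: "u = v" if "line_embedding A U L u = line_embedding A U L v" for u v
  proof -
    obtain p l q m where u: "u = (p, l)" "v = (q, m)" by (cases u, cases v)
    have "p = q" "map (?f p l) L = map (?f q m) L" using that unfolding u le by auto
    then have "\<forall>x\<in>set L. ?f p l x = ?f q m x" by (simp only: map_eq_conv)
    from bspec[OF this NL(1)] have "l = m" by simp
    then show ?thesis using u \<open>p = q\<close> by simp
  qed
  have 3: "(line_embedding A U L u, line_embedding A U L v) \<in> snd (power_graph N P (snd A))
       \<longleftrightarrow> (u, v) \<in> snd P" if uv: "u \<in> fst P" "v \<in> fst P" for u v
  proof -
    obtain p l q m where u: "u = (p, l)" "v = (q, m)" by (cases u, cases v)
    have fixed: "adj (snd P) p q (?f p l (Some a)) (?f q m (Some a)) \<longleftrightarrow> (p, q) \<in> snd A"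
      if a: "Some a \<in> set L" for a
    proof (cases "p \<in> fst A \<and> q \<in> fst A")
      case True
      then have "(p, label (U a) p) \<in> U a" "(q, label (U a) q) \<in> U a"
        using label_transversal(1)[OF U[OF lt[OF a]]] by auto
      then show ?thesis using U[OF lt[OF a]] True by (force simp: transversals_def)
    next
      case False
      \<comment> \<open>Outside the parts of \<open>A\<close> a fixed coordinate holds
        \<open>None\<close>, and \<open>A\<close> has no edge there.\<close>
      then show ?thesis using A by auto
    qed
    have active: "adj (snd P) p q (?f p l None) (?f q m None) \<longleftrightarrow> (u, v) \<in> snd P" by (simp add: u)
    have "power_adj (snd P) (snd A) p q (map (?f p l) L) (map (?f q m) L) \<longleftrightarrow> (u, v) \<in> snd P"
    proof (cases "(p, q) \<in> snd A")
      case True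
      have "(\<forall>x\<in>set L. adj (snd P) p q (?f p l x) (?f q m x)) \<longleftrightarrow> (u, v) \<in> snd P" (is "?l \<longleftrightarrow> ?r")
      proof
        assume ?l
        from bspec[OF this NL(1)] show ?r using active by simp
      next
        assume ?r
        show ?l
        proof
          fix x assume x: "x \<in> set L"
          show "adj (snd P) p q (?f p l x) (?f q m x)"
          proof (cases x)
            case None
            show ?thesis unfolding None using active \<open>?r\<close> by (rule iffD2)
          next
            case (Some a)
            show ?thesis unfolding Some using fixed[OF x[unfolded Some]] True by (rule iffD2)
          qed
        qed
      qed
      then show ?thesis using True by (simp add: power_adj_def all_set_conv_all_nth)
    next
      case False
      have "(\<exists>x\<in>set L. adj (snd P) p q (?f p l x) (?f q m x)) \<longleftrightarrow> (u, v) \<in> snd P" (is "?l \<longleftrightarrow> ?r")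
      proof
        assume ?l
        then obtain x where x: "x \<in> set L" "adj (snd P) p q (?f p l x) (?f q m x)" by blast
        show ?r
        proof (cases x)
          case None
          show ?thesis using active x(2)[unfolded None] by (rule iffD1)
        next
          case (Some a)
          show ?thesis using fixed[OF x(1)[unfolded Some]] x(2)[unfolded Some] False by blast
        qed
      next
        assume ?r
        then show ?l by (intro bexI[OF _ NL(1)] iffD2[OF active])
      qed
      then show ?thesis using False by (auto simp: power_adj_def Bex_def in_set_conv_nth)
    qed
    then show ?thesis using 1[OF uv(1)] 1[OF uv(2)] unfolding u le power_graph_edge by simp
  qed
  have 4: "fst (line_embedding A U L u) = fst u" for u
    by (simp add: line_embedding_def split: prod.split)
  show ?thesis unfolding part_embedding_def
    by (intro conjI ballI image_subsetI inj_onI) (rule 1 2 3 4; assumption)+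
qed

section \<open>Amplification for one pattern and for finitely many patterns\<close>

definition transversal_ramsey ::
    "'c set \<Rightarrow> 'p graph set \<Rightarrow> ('p \<times> 'l) graph \<Rightarrow> ('p \<times> 'l) graph \<Rightarrow> bool" where
  "transversal_ramsey K \<A> P P' \<longleftrightarrow> (\<forall>\<chi>. (\<forall>U. \<chi> U \<in> K) \<longrightarrow>
     (\<exists>\<phi>. part_embedding P P' \<phi> \<and>
        (\<forall>A\<in>\<A>. \<exists>i\<in>K. \<forall>U\<in>transversals P A. \<chi> (\<phi> ` U) = i)))"

lemma transversal_ramseyE:
  assumes "transversal_ramsey K \<A> P P'" "\<And>U. \<chi> U \<in> K"
  obtains \<phi> where "part_embedding P P' \<phi>"
    "\<forall>A\<in>\<A>. \<exists>i\<in>K. \<forall>U\<in>transversals P A. \<chi> (\<phi> ` U) = i"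
proof -
  have "\<exists>\<phi>. part_embedding P P' \<phi> \<and> (\<forall>A\<in>\<A>. \<exists>i\<in>K. \<forall>U\<in>transversals P A. \<chi> (\<phi> ` U) = i)"
    using assms(1)[unfolded transversal_ramsey_def, rule_format, of \<chi>] assms(2) by simp
  then show thesis using that by auto
qed

lemma transversal_ramsey_single:
  fixes P :: "('p \<times> nat) graph" and K :: "'c set"
  assumes P: "partite B D P" and A: "snd A \<subseteq> fst A \<times> fst A" "sym (snd A)" and K: "finite K"
  shows "\<exists>P'. partite B D P' \<and> transversal_ramsey K {A} P P'"
proof -
  have "transversals P A \<subseteq> Pow (fst P)" by (auto simp: transversals_def)
  then have "finite (transversals P A)" using P by (auto simp: partite_def intro: finite_subset)
  \<comment> \<open>The alphabet enumerates the transversals that induce \<open>A\<close>; it may be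
    empty, and repetitions do no harm.\<close>
  then obtain U and r :: nat where U: "transversals P A = U ` {..<r}"
    unfolding finite_conv_nat_seg_image lessThan_def by blast
  obtain N where N: "\<forall>\<chi>. (\<forall>w. \<chi> w \<in> K) \<longrightarrow> (\<exists>L\<in>comb_lines N r. \<exists>i. \<forall>a<r. \<chi> (inst L a) = i)"
    using hales_jewett[OF K, of r] ..
  show ?thesis
  proof (cases "K = {}")
    case True
    then have "transversal_ramsey K {A} P P" by (simp add: transversal_ramsey_def)
    then show ?thesis using P by blast
  next
    case False
    then obtain k where "k \<in> K" by blast
    \<comment> \<open>A constant colouring suffices to exhibit a line, and its active coordinate
      shows \<open>N > 0\<close>.\<close>
    then obtain L where "L \<in> comb_lines N r" using N[rule_format, of "\<lambda>_. k"] by blast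
    then have "N > 0" by (auto simp: comb_lines_def)
    then have "partite B D (power_graph N P (snd A))" using partite_power_graph[OF P A(2)] by blast
    moreover have "transversal_ramsey K {A} P (power_graph N P (snd A))"
      unfolding transversal_ramsey_def
    proof (intro allI impI)
      fix \<chi> :: "('p \<times> nat) set \<Rightarrow> 'c" assume \<chi>: "\<forall>U. \<chi> U \<in> K"
      obtain L i where L: "L \<in> comb_lines N r" "\<forall>a<r. \<chi> (word_transversal A U (inst L a)) = i"
        using N[rule_format, of "\<lambda>w. \<chi> (word_transversal A U w)"] \<chi> by blast
      have "\<chi> (line_embedding A U L ` T) = i" if "T \<in> transversals P A" for T
      proof -
        obtain a where a: "a < r" "T = U a" using U \<open>T \<in> transversals P A\<close> by auto
        then have "U a \<in> transversals P A" using that by simp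
        then show ?thesis using line_embedding_transversal[of U a P A L] L(2) a by simp
      qed
      then have "\<exists>i\<in>K. \<forall>T\<in>transversals P A. \<chi> (line_embedding A U L ` T) = i"
        using \<chi> \<open>k \<in> K\<close> by (metis (no_types, lifting))
      moreover have "part_embedding P (power_graph N P (snd A)) (line_embedding A U L)"
        using P A U L(1) by (intro part_embedding_line[of _ r]) (auto simp: partite_def)
      ultimately show "\<exists>\<phi>. part_embedding P (power_graph N P (snd A)) \<phi> \<and>
        (\<forall>A\<in>{A}. \<exists>i\<in>K. \<forall>U\<in>transversals P A. \<chi> (\<phi> ` U) = i)" by blast
    qed
    ultimately show ?thesis by blast
  qed
qed

text \<open>In the tower \<open>P\<close>, \<open>P'\<close>, \<open>P''\<close> the colouring is
  first made constant on \<open>A\<close> within a copy of \<open>P'\<close>, and only then the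
  patterns in \<open>\<A>\<close> are served inside that copy. Constancy on \<open>A\<close>
  survives because embeddings send transversals to transversals.\<close>

lemma transversal_ramsey_finite:
  fixes P :: "('p \<times> nat) graph" and K :: "'c set"
  assumes P: "partite B D P" and K: "finite K" and "finite \<A>"
    and "\<And>A. A \<in> \<A> \<Longrightarrow> snd A \<subseteq> fst A \<times> fst A \<and> sym (snd A)"
  shows "\<exists>P'. partite B D P' \<and> transversal_ramsey K \<A> P P'"
  using assms(3,4)
proof (induction rule: finite_induct)
  case empty
  have "transversal_ramsey K {} P P"
    unfolding transversal_ramsey_def using part_embedding_id[of P] by (auto intro!: exI[of _ id])
  then show ?case using P by blast
next
  case (insert A \<A>)
  then obtain P' where P': "partite B D P'" "transversal_ramsey K \<A> P P'" by auto
  obtain P'' where P'': "partite B D P''" "transversal_ramsey K {A} P' P''"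
    using transversal_ramsey_single[OF P'(1) _ _ K] insert.prems[of A] by blast
  have "transversal_ramsey K (insert A \<A>) P P''"
    unfolding transversal_ramsey_def
  proof (intro allI impI)
    fix \<chi> :: "('p \<times> nat) set \<Rightarrow> 'c" assume \<chi>: "\<forall>U. \<chi> U \<in> K"
    obtain \<phi> where \<phi>: "part_embedding P' P'' \<phi>"
      "\<forall>A\<in>{A}. \<exists>i\<in>K. \<forall>U\<in>transversals P' A. \<chi> (\<phi> ` U) = i"
      by (rule transversal_ramseyE[OF P''(2), of \<chi>, OF \<chi>[rule_format]])
    obtain \<psi> where \<psi>: "part_embedding P P' \<psi>"
      "\<forall>A\<in>\<A>. \<exists>i\<in>K. \<forall>U\<in>transversals P A. \<chi> (\<phi> ` \<psi> ` U) = i"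
      by (rule transversal_ramseyE[OF P'(2), of "\<lambda>U. \<chi> (\<phi> ` U)", OF \<chi>[rule_format]])
    have "\<exists>i\<in>K. \<forall>U\<in>transversals P A'. \<chi> ((\<phi> \<circ> \<psi>) ` U) = i" if "A' \<in> insert A \<A>" for A'
    proof (cases "A' \<in> \<A>")
      case True
      then show ?thesis using bspec[OF \<psi>(2), of A'] by (simp add: image_comp)
    next
      case False
      with that have "A' = A" by simp
      then obtain i where "i \<in> K" and i: "\<forall>U\<in>transversals P' A'. \<chi> (\<phi> ` U) = i" using \<phi>(2) by auto
      have "\<chi> ((\<phi> \<circ> \<psi>) ` U) = i" if "U \<in> transversals P A'" for U
        unfolding image_comp[symmetric] using i part_embedding_transversals[OF \<psi>(1) that] by blast
      then show ?thesis using \<open>i \<in> K\<close> by blast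
    qed
    then show "\<exists>\<phi>. part_embedding P P'' \<phi> \<and>
        (\<forall>A\<in>insert A \<A>. \<exists>i\<in>K. \<forall>U\<in>transversals P A. \<chi> (\<phi> ` U) = i)"
      by (intro exI[of _ "\<phi> \<circ> \<psi>"] conjI ballI part_embedding_comp[OF \<psi>(1) \<phi>(1)])
  qed
  then show ?case using P''(1) by blast
qed

section \<open>A canonical Ramsey theorem for coloured graphs\<close>

definition rank :: "('a \<Rightarrow> 'b::linorder) \<Rightarrow> 'a set \<Rightarrow> 'a \<Rightarrow> nat" where
  "rank r H y = card {z \<in> H. r z < r y}"

lemma rank_less_iff:
  assumes "finite H" "x \<in> H" "y \<in> H"
  shows "rank r H x < rank r H y \<longleftrightarrow> r x < r y"
proof -
  have *: "rank r H u < rank r H v" if "r u < r v" "u \<in> H" for u v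
    unfolding rank_def using that assms(1) by (intro psubset_card_mono) force+
  have "rank r H y \<le> rank r H x" if "r y \<le> r x"
    unfolding rank_def using that assms(1) by (intro card_mono) auto
  then show ?thesis using * assms by (meson not_less)
qed

lemma rank_less_card:
  assumes "finite H" "y \<in> H"
  shows "rank r H y < card H"
  unfolding rank_def using assms by (intro psubset_card_mono) auto

lemma bij_betw_rank:
  assumes "finite H" "inj_on r H"
  shows "bij_betw (rank r H) H {..<card H}"
proof -
  have "x = y" if "x \<in> H" "y \<in> H" "rank r H x = rank r H y" for x y
  proof -
    have "\<not> r x < r y" "\<not> r y < r x"
      using rank_less_iff[OF assms(1), of _ _ r] that by (metis less_irrefl)+
    then show ?thesis using assms(2) that by (auto simp: inj_on_def)
  qed
  then have inj: "inj_on (rank r H) H" by (auto intro: inj_onI)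
  have "rank r H ` H \<subseteq> {..<card H}" using rank_less_card[OF assms(1)] by auto
  then have "rank r H ` H = {..<card H}"
    using inj by (intro card_subset_eq) (auto simp: card_image)
  then show ?thesis using inj by (simp add: bij_betw_def)
qed

lemma rank_transfer:
  assumes h: "bij_betw h H S" and "\<And>x y. x \<in> H \<Longrightarrow> y \<in> H \<Longrightarrow> r x < r y \<longleftrightarrow> s (h x) < s (h y)" "y \<in> H"
  shows "rank s S (h y) = rank r H y"
proof -
  have "{z \<in> S. s z < s (h y)} = h ` {z \<in> H. r z < r y}"
    using assms by (force simp: bij_betw_def)
  moreover have "inj_on h {z \<in> H. r z < r y}"
    using h by (auto simp: bij_betw_def inj_on_def)
  ultimately show ?thesis by (simp add: rank_def card_image)
qed

text \<open>The increasing bijection from \<open>H\<close>, ordered by \<open>r\<close>, onto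
  \<open>S\<close>, when both are finite of equal size and \<open>r\<close> is injective on
  \<open>H\<close>.\<close>

definition place :: "('a \<Rightarrow> 'b::linorder) \<Rightarrow> 'a set \<Rightarrow> nat set \<Rightarrow> 'a \<Rightarrow> nat" where
  "place r H S y = inv_into S (rank id S) (rank r H y)"

lemma place_in:
  assumes "finite H" "finite S" "card S = card H" "y \<in> H"
  shows "place r H S y \<in> S" "rank id S (place r H S y) = rank r H y"
proof -
  have b: "bij_betw (rank id S) S {..<card S}" using assms(2) by (intro bij_betw_rank) auto
  have "rank r H y \<in> rank id S ` S"
    using b rank_less_card[OF assms(1,4)] assms(3) by (auto simp: bij_betw_def)
  then show "place r H S y \<in> S" "rank id S (place r H S y) = rank r H y"
    unfolding place_def by (auto intro: inv_into_into f_inv_into_f)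
qed

lemma place_less:
  assumes "finite H" "finite S" "card S = card H" "x \<in> H" "y \<in> H"
  shows "place r H S x < place r H S y \<longleftrightarrow> r x < r y"
  using rank_less_iff[OF assms(2) place_in(1)[OF assms(1-4), of r] place_in(1)[OF assms(1-3,5), of r], of id]
    rank_less_iff[OF assms(1,4,5), of r]
  by (simp add: place_in(2)[OF assms(1-4), of r] place_in(2)[OF assms(1-3,5), of r])

lemma inj_on_place:
  assumes "finite H" "finite S" "card S = card H" "inj_on r H"
  shows "inj_on (place r H S) H"
proof (rule inj_onI)
  fix x y assume xy: "x \<in> H" "y \<in> H" "place r H S x = place r H S y"
  then have "\<not> r x < r y" "\<not> r y < r x"
    using place_less[OF assms(1-3) xy(1,2), of r] place_less[OF assms(1-3) xy(2,1), of r] by simp_all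
  then have "r x = r y" by simp
  then show "x = y" using inj_onD[OF assms(4)] xy by blast
qed

lemma place_unique:
  assumes "finite S" "bij_betw h H S"
    and "\<And>x y. x \<in> H \<Longrightarrow> y \<in> H \<Longrightarrow> r x < r y \<longleftrightarrow> h x < h y" "y \<in> H"
  shows "place r H S y = h y"
proof -
  have "rank id S (h y) = rank r H y" using assms by (intro rank_transfer) auto
  moreover have "inj_on (rank id S) S" using bij_betw_rank[OF assms(1), of id] by (simp add: bij_betw_def)
  moreover have "h y \<in> S" using assms by (auto simp: bij_betw_def)
  ultimately show ?thesis unfolding place_def by (metis inv_into_f_f)
qed

definition same_type ::
    "'a rel \<Rightarrow> ('a \<Rightarrow> nat) \<Rightarrow> ('a \<Rightarrow> 'b::linorder) \<Rightarrow> 'a set \<Rightarrow> 'a set \<Rightarrow> bool" where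
  "same_type F c r H H' \<longleftrightarrow> (\<exists>g. bij_betw g H H' \<and> (\<forall>x\<in>H. c (g x) = c x) \<and>
     (\<forall>x\<in>H. \<forall>y\<in>H. (r x < r y \<longleftrightarrow> r (g x) < r (g y)) \<and> ((x, y) \<in> F \<longleftrightarrow> (g x, g y) \<in> F)))"

text \<open>The colour belongs to the part, beside the position, so that it can still be read off
  after amplification.\<close>

definition vertex_part ::
    "('a \<Rightarrow> nat) \<Rightarrow> ('a \<Rightarrow> 'b::linorder) \<Rightarrow> nat set \<Rightarrow> 'a set \<Rightarrow> 'a \<Rightarrow> nat \<times> nat" where
  "vertex_part c r S H y = (place r H S y, c y)"

definition pattern ::
    "'a rel \<Rightarrow> ('a \<Rightarrow> nat) \<Rightarrow> ('a \<Rightarrow> 'b::linorder) \<Rightarrow> nat set \<Rightarrow> 'a set \<Rightarrow> (nat \<times> nat) graph" where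
  "pattern F c r S H = (vertex_part c r S H ` H,
     map_prod (vertex_part c r S H) (vertex_part c r S H) ` (F \<inter> H \<times> H))"

text \<open>An order-preserving bijection preserves ranks and hence the places in \<open>S\<close>;
  colours and edges are preserved by assumption.\<close>

lemma pattern_same_type:
  assumes "same_type F c r H H'"
  shows "pattern F c r S H = pattern F c r S H'"
proof -
  obtain g where g: "bij_betw g H H'" "\<And>x. x \<in> H \<Longrightarrow> c (g x) = c x"
    "\<And>x y. x \<in> H \<Longrightarrow> y \<in> H \<Longrightarrow> r x < r y \<longleftrightarrow> r (g x) < r (g y)"
    "\<And>x y. x \<in> H \<Longrightarrow> y \<in> H \<Longrightarrow> (x, y) \<in> F \<longleftrightarrow> (g x, g y) \<in> F"
    using assms unfolding same_type_def by blast
  have p: "vertex_part c r S H' (g y) = vertex_part c r S H y" if "y \<in> H" for y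
    using that g(2) rank_transfer[of g H H' r r y, OF g(1) g(3)] by (simp add: vertex_part_def place_def)
  have H': "H' = g ` H" using g(1) by (simp add: bij_betw_def)
  have F: "F \<inter> H' \<times> H' = map_prod g g ` (F \<inter> H \<times> H)"
    using g(4) unfolding H' by force
  have "map_prod (vertex_part c r S H') (vertex_part c r S H') ` (F \<inter> H' \<times> H') =
        map_prod (vertex_part c r S H) (vertex_part c r S H) ` (F \<inter> H \<times> H)"
    unfolding F image_image by (rule image_cong) (auto simp: p)
  moreover have "vertex_part c r S H' ` H' = vertex_part c r S H ` H"
    unfolding H' image_image by (rule image_cong) (simp_all add: p[unfolded H'])
  ultimately show ?thesis by (simp add: pattern_def)
qed

lemma mem_map_prod_image:
  assumes "inj_on f A" "R \<subseteq> A \<times> A" "x \<in> A" "y \<in> A"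
  shows "(f x, f y) \<in> map_prod f f ` R \<longleftrightarrow> (x, y) \<in> R"
proof
  assume "(f x, f y) \<in> map_prod f f ` R"
  then obtain u v where *: "(u, v) \<in> R" "f x = f u" "f y = f v" by auto
  then have "x = u" "y = v" using assms(2-4) inj_onD[OF assms(1)] by blast+
  then show "(x, y) \<in> R" using * by simp
next
  assume "(x, y) \<in> R"
  then show "(f x, f y) \<in> map_prod f f ` R" using imageI[of "(x, y)" R "map_prod f f"] by simp
qed

text \<open>The second component encodes the set of positions and keeps the copies disjoint.\<close>

definition placed_vertex ::
    "('a \<Rightarrow> nat) \<Rightarrow> ('a \<Rightarrow> 'b::linorder) \<Rightarrow> 'a set \<Rightarrow> nat set \<Rightarrow> 'a \<Rightarrow> (nat \<times> nat) \<times> nat" where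
  "placed_vertex c r Y Q y = (vertex_part c r Q Y y, set_encode Q)"

definition placed_copies ::
    "nat \<Rightarrow> 'a graph \<Rightarrow> ('a \<Rightarrow> nat) \<Rightarrow> ('a \<Rightarrow> 'b::linorder) \<Rightarrow> ((nat \<times> nat) \<times> nat) graph" where
  "placed_copies N G c r =
     (\<Union>Q\<in>{Q. Q \<subseteq> {..<N} \<and> card Q = card (fst G)}. placed_vertex c r (fst G) Q ` fst G,
      \<Union>Q\<in>{Q. Q \<subseteq> {..<N} \<and> card Q = card (fst G)}.
        map_prod (placed_vertex c r (fst G) Q) (placed_vertex c r (fst G) Q) ` snd G)"

context
  fixes Y :: "'a set" and F :: "'a rel" and c :: "'a \<Rightarrow> nat" and r :: "'a \<Rightarrow> 'b::linorder" and n :: nat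
  assumes G: "finite_graph (Y, F)" and c: "proper_coloring n (Y, F) c" and r: "inj_on r Y"
begin

lemma finite_placed: "finite Y"
  using G by simp

lemma inj_on_vertex_part:
  assumes "finite Q" "card Q = card Y"
  shows "inj_on (vertex_part c r Q Y) Y"
  using inj_on_place[OF finite_placed assms r] by (auto simp: inj_on_def vertex_part_def)

lemma placed_vertex_eqD:
  assumes "Q \<subseteq> {..<N}" "card Q = card Y" "Q' \<subseteq> {..<N}"
    and "placed_vertex c r Y Q x = placed_vertex c r Y Q' y" "x \<in> Y" "y \<in> Y"
  shows "Q = Q'" "x = y"
proof -
  have fin: "finite Q" "finite Q'" using assms(1,3) finite_subset by blast+
  have eq: "vertex_part c r Q Y x = vertex_part c r Q' Y y" "set_encode Q = set_encode Q'"
    using assms(4) by (auto simp: placed_vertex_def)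
  then show "Q = Q'" using fin by (simp add: set_encode_eq)
  then show "x = y" using inj_on_vertex_part[OF fin(1) assms(2)] eq(1) assms(5,6) by (simp add: inj_on_def)
qed

lemma placed_copies_edgeE:
  assumes "(u, v) \<in> snd (placed_copies N (Y, F) c r)"
  obtains Q x y where "Q \<subseteq> {..<N}" "card Q = card Y" "(x, y) \<in> F" "x \<in> Y" "y \<in> Y"
    "u = placed_vertex c r Y Q x" "v = placed_vertex c r Y Q y"
proof -
  obtain Q x y where *: "Q \<subseteq> {..<N}" "card Q = card Y" "(x, y) \<in> F"
    "u = placed_vertex c r Y Q x" "v = placed_vertex c r Y Q y"
    using assms by (auto simp: placed_copies_def)
  moreover have "x \<in> Y" "y \<in> Y" using *(3) G by auto
  ultimately show thesis using that by blast
qed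

lemma placed_copies_vertex:
  assumes "Q \<subseteq> {..<N}" "card Q = card Y" "x \<in> Y"
  shows "placed_vertex c r Y Q x \<in> fst (placed_copies N (Y, F) c r)"
  using assms by (auto simp: placed_copies_def)

lemma placed_copies_edge:
  assumes "Q \<subseteq> {..<N}" "card Q = card Y" "x \<in> Y" "y \<in> Y"
  shows "(placed_vertex c r Y Q x, placed_vertex c r Y Q y) \<in> snd (placed_copies N (Y, F) c r) \<longleftrightarrow> (x, y) \<in> F"
proof
  assume "(placed_vertex c r Y Q x, placed_vertex c r Y Q y) \<in> snd (placed_copies N (Y, F) c r)"
  then obtain Q' x' y' where Q': "Q' \<subseteq> {..<N}" and F': "(x', y') \<in> F" "x' \<in> Y" "y' \<in> Y"
    and eq: "placed_vertex c r Y Q x = placed_vertex c r Y Q' x'" "placed_vertex c r Y Q y = placed_vertex c r Y Q' y'"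
    by (rule placed_copies_edgeE)
  then show "(x, y) \<in> F"
    using placed_vertex_eqD(2)[OF assms(1,2) Q' eq(1) assms(3)] placed_vertex_eqD(2)[OF assms(1,2) Q' eq(2) assms(4)] F'
    by simp
next
  assume "(x, y) \<in> F"
  then have "(placed_vertex c r Y Q x, placed_vertex c r Y Q y) \<in>
      map_prod (placed_vertex c r Y Q) (placed_vertex c r Y Q) ` F"
    using imageI[of "(x, y)" F "map_prod (placed_vertex c r Y Q) (placed_vertex c r Y Q)"] by simp
  then show "(placed_vertex c r Y Q x, placed_vertex c r Y Q y) \<in> snd (placed_copies N (Y, F) c r)"
    unfolding placed_copies_def fst_conv snd_conv
    by (intro UN_I[of Q]) (simp_all only: mem_Collect_eq assms(1,2) simp_thms)
qed

lemma partite_placed_copies: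
  "partite ({..<N} \<times> {1..n}) {(p, q). snd p \<noteq> snd q} (placed_copies N (Y, F) c r)"
proof -
  let ?P = "placed_copies N (Y, F) c r"
  have "finite {Q. Q \<subseteq> {..<N} \<and> card Q = card Y}" by (rule finite_subset[of _ "Pow {..<N}"]) auto
  then have 1: "finite (fst ?P)" using finite_placed by (simp add: placed_copies_def)
  have "place r Y Q y < N" if "Q \<subseteq> {..<N}" "card Q = card Y" "y \<in> Y" for Q y
    using place_in(1)[OF finite_placed _ that(2,3)] that(1) finite_subset[OF that(1)] by blast
  then have 2: "fst ` fst ?P \<subseteq> {..<N} \<times> {1..n}"
    using c by (auto simp: placed_copies_def placed_vertex_def vertex_part_def)
  have 3: "snd ?P \<subseteq> fst ?P \<times> fst ?P"
    by (auto elim!: placed_copies_edgeE intro: placed_copies_vertex)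
  have "sym F" using G by simp
  have 4: "sym (snd ?P)"
  proof (rule symI)
    fix u v assume "(u, v) \<in> snd ?P"
    then obtain Q x y where *: "Q \<subseteq> {..<N}" "card Q = card Y" "(x, y) \<in> F" "x \<in> Y" "y \<in> Y"
      "u = placed_vertex c r Y Q x" "v = placed_vertex c r Y Q y" by (rule placed_copies_edgeE)
    then show "(v, u) \<in> snd ?P"
      using placed_copies_edge[OF *(1,2,5,4)] symD[OF \<open>sym F\<close> *(3)] by simp
  qed
  have "c x \<noteq> c y" if "(x, y) \<in> F" for x y using c that by auto
  then have 5: "\<forall>(u, v)\<in>snd ?P. (fst u, fst v) \<in> {(p, q). snd p \<noteq> snd q}"
    by (auto elim!: placed_copies_edgeE simp: placed_vertex_def vertex_part_def)
  show ?thesis unfolding partite_def by (intro conjI 1 2 3 4 5)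
qed

text \<open>The increasing bijection of \<open>Y\<close> onto \<open>Q\<close>, restricted to
  \<open>H\<close>, is the increasing bijection of \<open>H\<close> onto its image. So the pattern
  depends on \<open>Q\<close> only through the positions occupied by \<open>H\<close>, which is what
  allows Ramsey's theorem to colour sets of positions.\<close>

lemma placed_vertex_image_transversal:
  assumes Q: "Q \<subseteq> {..<N}" "card Q = card Y" and H: "H \<subseteq> Y"
  shows "placed_vertex c r Y Q ` H \<in>
    transversals (placed_copies N (Y, F) c r) (pattern F c r (place r Y Q ` H) H)"
proof -
  let ?S = "place r Y Q ` H"
  have fin: "finite Q" "finite H" using Q H finite_placed finite_subset by blast+
  have inj: "inj_on (vertex_part c r Q Y) H" using inj_on_vertex_part[OF fin(1) Q(2)] H by (rule inj_on_subset)
  have less: "r x < r y \<longleftrightarrow> place r Y Q x < place r Y Q y" if "x \<in> H" "y \<in> H" for x y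
    using place_less[OF finite_placed fin(1) Q(2), of x y r] that H by auto
  have "inj_on (place r Y Q) H"
    using inj_on_subset[OF inj_on_place[OF finite_placed fin(1) Q(2) r] H] .
  then have "place r H ?S y = place r Y Q y" if "y \<in> H" for y
    using fin(2) less that by (intro place_unique) (auto simp: bij_betw_def)
  then have vp: "vertex_part c r ?S H y = vertex_part c r Q Y y" if "y \<in> H" for y
    using that by (simp add: vertex_part_def)
  have fst_pv: "fst (placed_vertex c r Y Q y) = vertex_part c r Q Y y" for y
    by (simp add: placed_vertex_def)
  have inj': "inj_on (vertex_part c r ?S H) H" using inj vp by (simp cong: inj_on_cong)
  have "placed_vertex c r Y Q ` H \<subseteq> fst (placed_copies N (Y, F) c r)"
    using placed_copies_vertex[OF Q] H by blast
  moreover have "bij_betw fst (placed_vertex c r Y Q ` H) (fst (pattern F c r ?S H))"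
    using inj by (auto simp: bij_betw_def inj_on_def fst_pv pattern_def image_image vp)
  moreover have "(placed_vertex c r Y Q x, placed_vertex c r Y Q y) \<in> snd (placed_copies N (Y, F) c r) \<longleftrightarrow>
      (fst (placed_vertex c r Y Q x), fst (placed_vertex c r Y Q y)) \<in> snd (pattern F c r ?S H)"
    if "x \<in> H" "y \<in> H" for x y
  proof -
    have "(vertex_part c r ?S H x, vertex_part c r ?S H y) \<in> snd (pattern F c r ?S H) \<longleftrightarrow> (x, y) \<in> F"
      unfolding pattern_def snd_conv
      using mem_map_prod_image[OF inj', of "F \<inter> H \<times> H" x y] that by auto
    moreover have "(placed_vertex c r Y Q x, placed_vertex c r Y Q y) \<in> snd (placed_copies N (Y, F) c r) \<longleftrightarrow> (x, y) \<in> F"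
      using placed_copies_edge[OF Q] that H by blast
    ultimately show ?thesis by (simp add: fst_pv vp that)
  qed
  ultimately show ?thesis unfolding transversals_def by blast
qed

lemma pattern_placed:
  assumes "S \<subseteq> {..<N}" "card S = card H" "H \<subseteq> Y"
  shows "fst (pattern F c r S H) \<subseteq> {..<N} \<times> {1..n}"
    "snd (pattern F c r S H) \<subseteq> fst (pattern F c r S H) \<times> fst (pattern F c r S H)"
    "sym (snd (pattern F c r S H))"
proof -
  have fin: "finite S" "finite H" using assms finite_placed finite_subset by blast+
  show "fst (pattern F c r S H) \<subseteq> {..<N} \<times> {1..n}"
    using place_in(1)[OF fin(2,1) assms(2)] assms c by (fastforce simp: pattern_def vertex_part_def)
  show "snd (pattern F c r S H) \<subseteq> fst (pattern F c r S H) \<times> fst (pattern F c r S H)"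
    by (auto simp: pattern_def)
  have "sym F" using G by simp
  then show "sym (snd (pattern F c r S H))" by (fastforce simp: pattern_def sym_def)
qed

text \<open>Once every pattern has a colour \<open>col\<close> of its own, \<open>Q\<close> is
  chosen such that \<open>col\<close> ignores the positions taken from \<open>Q\<close>; the copy
  placed on \<open>Q\<close> is the desired one. The function \<open>pos\<close> lets a colouring of
  unordered sets tell the two ends of a pair apart.\<close>

lemma canonical_ramsey:
  fixes K :: "'k set" and a :: nat
  assumes K: "finite K"
  shows "\<exists>(V :: 'v::infinite set) E (pos :: 'v \<Rightarrow> nat). (V, E) \<in> colorable_graphs n \<and>
    (\<forall>\<chi>. (\<forall>U. \<chi> U \<in> K) \<longrightarrow> (\<exists>\<psi>. inj_on \<psi> Y \<and> \<psi> ` Y \<subseteq> V \<and>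
       (\<forall>x\<in>Y. \<forall>y\<in>Y. (\<psi> x, \<psi> y) \<in> E \<longleftrightarrow> (x, y) \<in> F) \<and>
       (\<forall>x\<in>Y. \<forall>y\<in>Y. r x < r y \<longrightarrow> pos (\<psi> x) < pos (\<psi> y)) \<and>
       (\<forall>H H'. H \<subseteq> Y \<and> H' \<subseteq> Y \<and> card H = a \<and> same_type F c r H H' \<longrightarrow> \<chi> (\<psi> ` H) = \<chi> (\<psi> ` H'))))"
proof -
  let ?HH = "{H. H \<subseteq> Y \<and> card H = a}"
  have "finite ?HH" by (rule finite_subset[of _ "Pow Y"]) (use finite_placed in auto)
  then have "finite (?HH \<rightarrow>\<^sub>E K)" using K by (intro finite_PiE) auto
  \<comment> \<open>The colour of a set of positions is the whole list of colours that the
    \<open>a\<close>-subsets of \<open>Y\<close> receive when placed on it. \<open>N\<close> is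
    fixed first, since it determines the parts.\<close>
  from ramsey_finite_colours[OF this, of "card Y" a]
  obtain N :: nat where N: "\<forall>f. (\<forall>S. f S \<in> ?HH \<rightarrow>\<^sub>E K) \<longrightarrow>
    (\<exists>Q\<subseteq>{..<N}. card Q = card Y \<and> (\<exists>i. \<forall>S\<subseteq>Q. card S = a \<longrightarrow> f S = i))" ..
  let ?B = "{..<N} \<times> {1..n}"
  let ?P = "placed_copies N (Y, F) c r"
  define \<A> where "\<A> = {A :: (nat \<times> nat) graph. fst A \<subseteq> ?B \<and> snd A \<subseteq> fst A \<times> fst A \<and> sym (snd A)}"
  have "\<A> \<subseteq> Pow ?B \<times> Pow (?B \<times> ?B)" unfolding \<A>_def by force
  then have "finite \<A>" by (rule finite_subset) simp
  from transversal_ramsey_finite[OF partite_placed_copies[of N] K this]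
  obtain P' where P': "partite ?B {(p, q). snd p \<noteq> snd q} P'" "transversal_ramsey K \<A> ?P P'"
    unfolding \<A>_def by blast
  obtain V' E' where VE: "P' = (V', E')" by (cases P')
  have finV: "finite V'" and E'V: "E' \<subseteq> V' \<times> V'" and symE: "sym E'" using P'(1) VE by (auto simp: partite_def)
  have VB: "fst v \<in> ?B" if "v \<in> V'" for v using P'(1) VE that by (auto simp: partite_def)
  have ED: "snd (fst u) \<noteq> snd (fst v)" if "(u, v) \<in> E'" for u v
    using P'(1) VE that by (fastforce simp: partite_def)
  \<comment> \<open>The partite graph has pairs as vertices; \<open>j\<close> moves it into the
    infinite type of the statement.\<close>
  obtain W :: "'v set" where W: "finite W" "card W = card V'"
    using infinite_arbitrarily_large[OF infinite_UNIV] by blast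
  then obtain j where j: "bij_betw j V' W" using finite_same_card_bij[OF finV] by metis
  then have injj: "inj_on j V'" by (simp add: bij_betw_def)
  let ?V = "j ` V'" and ?E = "map_prod j j ` E'"
  let ?i = "inv_into V' j"
  have ij: "?i (j v) = v" if "v \<in> V'" for v using injj that by simp
  have Eiff: "(j u, j v) \<in> ?E \<longleftrightarrow> (u, v) \<in> E'" if "u \<in> V'" "v \<in> V'" for u v
    using mem_map_prod_image[OF injj E'V that] .
  have "proper_coloring n (?V, ?E) (\<lambda>v. snd (fst (?i v)))"
    using VB ED E'V ij by (fastforce simp: subset_iff)
  moreover have "finite_graph (?V, ?E)"
  proof -
    have "irrefl ?E" using ED E'V injj by (fastforce simp: irrefl_def inj_on_def)
    moreover have "sym ?E" using symE by (fastforce simp: sym_def)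
    ultimately show ?thesis using finV E'V by auto
  qed
  ultimately have col: "(?V, ?E) \<in> colorable_graphs n" unfolding colorable_graphs_def by blast
  have "\<exists>\<psi>. inj_on \<psi> Y \<and> \<psi> ` Y \<subseteq> ?V \<and>
       (\<forall>x\<in>Y. \<forall>y\<in>Y. (\<psi> x, \<psi> y) \<in> ?E \<longleftrightarrow> (x, y) \<in> F) \<and>
       (\<forall>x\<in>Y. \<forall>y\<in>Y. r x < r y \<longrightarrow> fst (fst (?i (\<psi> x))) < fst (fst (?i (\<psi> y)))) \<and>
       (\<forall>H H'. H \<subseteq> Y \<and> H' \<subseteq> Y \<and> card H = a \<and> same_type F c r H H' \<longrightarrow> \<chi> (\<psi> ` H) = \<chi> (\<psi> ` H'))"
    if \<chi>: "\<forall>U. \<chi> U \<in> K" for \<chi> :: "'v set \<Rightarrow> 'k"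
  proof -
    obtain \<phi> where \<phi>: "part_embedding ?P P' \<phi>"
      and "\<forall>A\<in>\<A>. \<exists>i\<in>K. \<forall>U\<in>transversals ?P A. \<chi> (j ` \<phi> ` U) = i"
      by (rule transversal_ramseyE[OF P'(2), of "\<lambda>U. \<chi> (j ` U)", OF \<chi>[rule_format]])
    then have "\<forall>A. \<exists>i. i \<in> K \<and> (A \<in> \<A> \<longrightarrow> (\<forall>U\<in>transversals ?P A. \<chi> (j ` \<phi> ` U) = i))"
      using \<chi> by blast
    from choice[OF this] obtain col where col: "\<And>A. col A \<in> K"
      "\<And>A U. A \<in> \<A> \<Longrightarrow> U \<in> transversals ?P A \<Longrightarrow> \<chi> (j ` \<phi> ` U) = col A" by blast
    have "\<forall>S. (\<lambda>H\<in>?HH. col (pattern F c r S H)) \<in> ?HH \<rightarrow>\<^sub>E K" using col(1) by auto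
    from N[rule_format, of "\<lambda>S. \<lambda>H\<in>?HH. col (pattern F c r S H)", OF this[rule_format]]
    obtain Q i where Q: "Q \<subseteq> {..<N}" "card Q = card Y"
      and i: "\<forall>S\<subseteq>Q. card S = a \<longrightarrow> (\<lambda>H\<in>?HH. col (pattern F c r S H)) = i" by blast
    have finQ: "finite Q" using Q(1) finite_subset by blast
    let ?\<kappa> = "placed_vertex c r Y Q"
    let ?S = "\<lambda>H. place r Y Q ` H"
    note placeinj = inj_on_place[OF finite_placed finQ Q(2) r]
    have S: "?S H \<subseteq> Q" "card (?S H) = a" if "H \<subseteq> Y" "card H = a" for H
      using place_in(1)[OF finite_placed finQ Q(2), of _ r] that
        card_image[OF inj_on_subset[OF placeinj that(1)]] by auto
    have colS: "col (pattern F c r S H) = i H" if "S \<subseteq> Q" "card S = a" "H \<subseteq> Y" "card H = a" for S H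
      using i[rule_format, OF that(1,2)] that(3,4) by (metis (mono_tags, lifting) mem_Collect_eq restrict_apply')
    have \<chi>H: "\<chi> (j ` \<phi> ` ?\<kappa> ` H) = i H" if H: "H \<subseteq> Y" "card H = a" for H
    proof -
      have "pattern F c r (?S H) H \<in> \<A>"
        using pattern_placed[of "?S H" N H] S[OF H] Q(1) H unfolding \<A>_def by auto
      from col(2)[OF this placed_vertex_image_transversal[OF Q H(1)]] show ?thesis
        using colS[OF S[OF H] H] by simp
    qed
    \<comment> \<open>\<open>H'\<close> is placed on the positions of \<open>H\<close>, where both
      have the same pattern, and its colour \<open>i H'\<close> does not depend on the
      positions.\<close>
    have main: "\<chi> (j ` \<phi> ` ?\<kappa> ` H) = \<chi> (j ` \<phi> ` ?\<kappa> ` H')"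
      if "H \<subseteq> Y" "H' \<subseteq> Y" "card H = a" "same_type F c r H H'" for H H'
    proof -
      have "card H' = a" using that(3,4) bij_betw_same_card unfolding same_type_def by metis
      then show ?thesis
        using \<chi>H that colS[OF S[OF that(1,3)]] pattern_same_type[OF that(4), of "?S H"] by metis
    qed
    have \<kappa>V: "?\<kappa> y \<in> fst ?P" if "y \<in> Y" for y using placed_copies_vertex[OF Q that] .
    have \<phi>V: "\<phi> u \<in> V'" "fst (\<phi> u) = fst u" if "u \<in> fst ?P" for u
      using \<phi> that VE by (auto simp: part_embedding_def)
    have \<phi>E: "(\<phi> u, \<phi> v) \<in> E' \<longleftrightarrow> (u, v) \<in> snd ?P" if "u \<in> fst ?P" "v \<in> fst ?P" for u v
      using \<phi> that VE by (auto simp: part_embedding_def)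
    have inj\<phi>: "inj_on \<phi> (fst ?P)" using \<phi> by (simp add: part_embedding_def)
    let ?\<psi> = "\<lambda>y. j (\<phi> (?\<kappa> y))"
    have 1: "inj_on ?\<psi> Y"
    proof (rule inj_onI)
      fix x y assume xy: "x \<in> Y" "y \<in> Y" "j (\<phi> (?\<kappa> x)) = j (\<phi> (?\<kappa> y))"
      then have "?\<kappa> x = ?\<kappa> y" using injj inj\<phi> \<kappa>V \<phi>V by (metis inj_onD)
      then show "x = y" using placed_vertex_eqD(2)[OF Q Q(1)] xy by blast
    qed
    have 2: "?\<psi> ` Y \<subseteq> ?V" using \<kappa>V \<phi>V(1) by blast
    have 3: "(?\<psi> x, ?\<psi> y) \<in> ?E \<longleftrightarrow> (x, y) \<in> F" if "x \<in> Y" "y \<in> Y" for x y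
      using Eiff[OF \<phi>V(1)[OF \<kappa>V[OF that(1)]] \<phi>V(1)[OF \<kappa>V[OF that(2)]]]
        \<phi>E[OF \<kappa>V[OF that(1)] \<kappa>V[OF that(2)]] placed_copies_edge[OF Q that] by simp
    have 4: "fst (fst (?i (?\<psi> x))) < fst (fst (?i (?\<psi> y)))" if "x \<in> Y" "y \<in> Y" "r x < r y" for x y
    proof -
      have "fst (fst (?i (?\<psi> z))) = place r Y Q z" if "z \<in> Y" for z
        unfolding ij[OF \<phi>V(1)[OF \<kappa>V[OF that]]] \<phi>V(2)[OF \<kappa>V[OF that]]
        by (simp add: placed_vertex_def vertex_part_def)
      then show ?thesis using that place_less[OF finite_placed finQ Q(2) that(1,2), of r] by simp
    qed
    have 5: "\<chi> (?\<psi> ` H) = \<chi> (?\<psi> ` H')"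
      if "H \<subseteq> Y \<and> H' \<subseteq> Y \<and> card H = a \<and> same_type F c r H H'" for H H'
      using main[of H H'] that by (simp add: image_image)
    show ?thesis
      by (intro exI[of _ ?\<psi>] conjI ballI allI impI) (rule 1 2 3 4 5; assumption)+
  qed
  then show ?thesis
    by (intro exI[of _ ?V] exI[of _ ?E] exI[of _ "\<lambda>v. fst (fst (?i v))"] conjI col allI impI) assumption
qed

end

section \<open>Types of extensions\<close>

lemma graph_iso_sym:
  assumes "graph_iso A B"
  shows "graph_iso B A"
proof -
  obtain X E Y F where AB: "A = (X, E)" "B = (Y, F)" by (cases A, cases B)
  obtain f where f: "bij_betw f X Y"
    "\<And>x y. x \<in> X \<Longrightarrow> y \<in> X \<Longrightarrow> (x, y) \<in> E \<longleftrightarrow> (f x, f y) \<in> F"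
    using assms unfolding AB by auto
  let ?g = "inv_into X f"
  have g: "?g y \<in> X" "f (?g y) = y" if "y \<in> Y" for y
    using f(1) that by (auto simp: bij_betw_def inv_into_into f_inv_into_f)
  show ?thesis unfolding AB
    using bij_betw_inv_into[OF f(1)] f(2) g by (auto intro!: exI[of _ ?g])
qed

lemma graph_iso_trans:
  assumes "graph_iso A B" "graph_iso B C"
  shows "graph_iso A C"
proof -
  obtain X E Y F Z G where ABC: "A = (X, E)" "B = (Y, F)" "C = (Z, G)"
    by (cases A, cases B, cases C)
  obtain f where f: "bij_betw f X Y"
    "\<And>x y. x \<in> X \<Longrightarrow> y \<in> X \<Longrightarrow> (x, y) \<in> E \<longleftrightarrow> (f x, f y) \<in> F"
    using assms(1) unfolding ABC by auto
  obtain g where g: "bij_betw g Y Z"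
    "\<And>x y. x \<in> Y \<Longrightarrow> y \<in> Y \<Longrightarrow> (x, y) \<in> F \<longleftrightarrow> (g x, g y) \<in> G"
    using assms(2) unfolding ABC by auto
  have fY: "f x \<in> Y" if "x \<in> X" for x using f(1) that by (auto simp: bij_betw_def)
  show ?thesis unfolding ABC
    using bij_betw_trans[OF f(1) g(1)] f(2) g(2) fY by (auto intro!: exI[of _ "g \<circ> f"])
qed

lemma graph_iso_card:
  assumes "graph_iso A B"
  shows "card (fst A) = card (fst B)"
  using assms by (cases A, cases B) (auto dest: bij_betw_same_card)

definition induced :: "'v graph \<Rightarrow> 'v set \<Rightarrow> 'v graph" where
  "induced G S = (S, snd G \<inter> S \<times> S)"

lemma copies_iff: "H \<in> copies G A \<longleftrightarrow> (\<exists>S\<subseteq>fst G. H = induced G S \<and> graph_iso H A)"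
  by (cases G) (auto simp: copies_def induced_def)

lemma induced_induced: "S \<subseteq> T \<Longrightarrow> induced (induced G T) S = induced G S"
  by (auto simp: induced_def)

lemma fst_induced [simp]: "fst (induced G S) = S"
  by (simp add: induced_def)

lemma copies_induced:
  shows "copies (induced G T) A = {induced G S | S. S \<subseteq> T \<and> graph_iso (induced G S) A}"
proof -
  have "H \<in> copies (induced G T) A \<longleftrightarrow> (\<exists>S. H = induced G S \<and> S \<subseteq> T \<and> graph_iso (induced G S) A)" for H
    unfolding copies_iff fst_induced by (intro iff_exI) (auto simp: induced_induced)
  then show ?thesis by (intro set_eqI) simp
qed

definition graph_embedding :: "'v graph \<Rightarrow> 'w graph \<Rightarrow> ('v \<Rightarrow> 'w) \<Rightarrow> bool" where
  "graph_embedding A B f \<longleftrightarrow> inj_on f (fst A) \<and> f ` fst A \<subseteq> fst B \<and>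
     (\<forall>x\<in>fst A. \<forall>y\<in>fst A. (f x, f y) \<in> snd B \<longleftrightarrow> (x, y) \<in> snd A)"

lemma graph_embedding_iso:
  assumes "graph_embedding A B f" "S \<subseteq> fst A"
  shows "graph_iso (induced A S) (induced B (f ` S))"
proof -
  have "bij_betw f S (f ` S)"
    using assms by (auto simp: graph_embedding_def bij_betw_def intro: inj_on_subset)
  moreover have "\<forall>x\<in>S. \<forall>y\<in>S. (x, y) \<in> snd A \<inter> S \<times> S \<longleftrightarrow> (f x, f y) \<in> snd B \<inter> (f ` S) \<times> (f ` S)"
    using assms by (auto simp: graph_embedding_def subset_iff)
  ultimately show ?thesis unfolding induced_def graph_iso.simps by blast
qed

section \<open>Monotone structures on subsets and their classes\<close>

fun oc_induced :: "'v ocgraph \<Rightarrow> 'v set \<Rightarrow> 'v ocgraph" where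
  "oc_induced (X, E, R, c) S = (S, E \<inter> S \<times> S, R \<inter> S \<times> S, restrict c S)"

lemma monotone_oc_induced:
  assumes "(X, E, R, c) \<in> monotone_ocgraphs n" "S \<subseteq> X"
  shows "oc_induced (X, E, R, c) S \<in> monotone_ocgraphs n"
proof -
  have X: "finite X" "E \<subseteq> X \<times> X" "irrefl E" "sym E"
    and R: "trans R" "irrefl R" "total_on X R" "\<forall>(x, y)\<in>R. c x \<le> c y"
    and c: "c \<in> X \<rightarrow> {1..n}" "\<forall>(x, y)\<in>E. c x \<noteq> c y"
    using assms(1) by (auto simp: monotone_ocgraphs_def strict_linear_order_on_def)
  have "finite S" using X(1) assms(2) by (rule rev_finite_subset)
  moreover have "irrefl (E \<inter> S \<times> S)" using X(3) by (auto simp: irrefl_def)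
  moreover have "sym (E \<inter> S \<times> S)" using X(4) by (auto simp: sym_def)
  moreover have "trans (R \<inter> S \<times> S)" using R(1) by (intro trans_Int) (auto simp: trans_def)
  moreover have "irrefl (R \<inter> S \<times> S)" using R(2) by (auto simp: irrefl_def)
  moreover have "total_on S (R \<inter> S \<times> S)" using R(3) assms(2) unfolding total_on_def by blast
  moreover have "proper_coloring n (S, E \<inter> S \<times> S) (restrict c S)"
    using c assms(2) by auto
  moreover have "\<forall>(x, y)\<in>R \<inter> S \<times> S. restrict c S x \<le> restrict c S y" using R(4) by auto
  ultimately show ?thesis
    unfolding oc_induced.simps monotone_ocgraphs_def strict_linear_order_on_def by simp
qed

definition rank_order :: "'a set \<Rightarrow> ('a \<Rightarrow> 'b::linorder) \<Rightarrow> 'a rel" where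
  "rank_order X r = {(x, y). x \<in> X \<and> y \<in> X \<and> r x < r y}"

text \<open>Sorting by colour first makes the order monotone; \<open>r0\<close> breaks ties
  arbitrarily.\<close>

lemma monotone_rank_order:
  assumes "finite_graph (X, E)" "proper_coloring n (X, E) c" "inj_on (r0 :: 'v \<Rightarrow> nat) X"
  shows "(X, E, rank_order X (\<lambda>x. (c x, r0 x)), restrict c X) \<in> monotone_ocgraphs n"
proof -
  have "total_on X (rank_order X (\<lambda>x. (c x, r0 x)))"
  proof (rule total_onI)
    fix x y assume xy: "x \<in> X" "y \<in> X" "x \<noteq> y"
    then have "(c x, r0 x) \<noteq> (c y, r0 y)" using assms(3) by (auto simp: inj_on_def)
    then show "(x, y) \<in> rank_order X (\<lambda>x. (c x, r0 x)) \<or> (y, x) \<in> rank_order X (\<lambda>x. (c x, r0 x))"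
      using xy unfolding neq_iff by (auto simp: rank_order_def)
  qed
  moreover have "trans (rank_order X (\<lambda>x. (c x, r0 x)))"
    by (rule transI) (auto simp: rank_order_def)
  moreover have "irrefl (rank_order X (\<lambda>x. (c x, r0 x)))"
    by (rule irreflI) (auto simp: rank_order_def)
  moreover have "proper_coloring n (X, E) (restrict c X)"
    using assms(1,2) by (auto simp: subset_iff)
  ultimately show ?thesis
    using assms(1) by (auto simp: monotone_ocgraphs_def strict_linear_order_on_def rank_order_def)
qed

text \<open>The isomorphism type of \<open>A\<close> as an element of the quotient counted by
  \<open>num_extensions\<close>, although \<open>A\<close> may live on other vertices than
  \<open>X\<close>.\<close>

definition ext_class :: "nat \<Rightarrow> 'v graph \<Rightarrow> 'v ocgraph \<Rightarrow> 'v ocgraph set" where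
  "ext_class n X A = {e \<in> extensions n X. ocgraph_iso e A}"

lemma ext_class_eq:
  assumes "e \<in> extensions n X" "ocgraph_iso e A"
  shows "ext_class n X A = iso_rel (extensions n X) `` {e}"
proof -
  have "ocgraph_iso e' A \<longleftrightarrow> ocgraph_iso e e'" for e'
    using assms(2) ocgraph_iso_sym ocgraph_iso_trans by metis
  then show ?thesis using assms(1) by (auto simp: ext_class_def iso_rel_def)
qed

text \<open>Order and colouring are pulled back along a graph isomorphism from \<open>X\<close>,
  which produces a member of the class.\<close>

lemma ext_class_in_quotient:
  assumes A: "(H, F, R, c) \<in> monotone_ocgraphs n" and iso: "graph_iso (H, F) X" and X: "finite_graph X"
  shows "ext_class n X (H, F, R, c) \<in> extensions n X // iso_rel (extensions n X)"
proof -
  obtain X0 E0 where XE: "X = (X0, E0)" by (cases X)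
  obtain g where g: "bij_betw g X0 H"
    "\<And>x y. x \<in> X0 \<Longrightarrow> y \<in> X0 \<Longrightarrow> (x, y) \<in> E0 \<longleftrightarrow> (g x, g y) \<in> F"
    using graph_iso_sym[OF iso] unfolding XE by auto
  have gH: "g x \<in> H" if "x \<in> X0" for x using g(1) that by (auto simp: bij_betw_def)
  have ginj: "g x = g y \<longleftrightarrow> x = y" if "x \<in> X0" "y \<in> X0" for x y
    using g(1) that by (auto simp: bij_betw_def inj_on_def)
  have R: "trans R" "irrefl R" "total_on H R" and c: "c \<in> H \<rightarrow> {1..n}" "\<And>x y. (x, y) \<in> F \<Longrightarrow> c x \<noteq> c y"
    "\<And>x y. (x, y) \<in> R \<Longrightarrow> c x \<le> c y"
    using A by (auto simp: monotone_ocgraphs_def strict_linear_order_on_def)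
  have E0: "E0 \<subseteq> X0 \<times> X0" using X XE by simp
  let ?R = "{(x, y). x \<in> X0 \<and> y \<in> X0 \<and> (g x, g y) \<in> R}" and ?c = "restrict (c \<circ> g) X0"
  have "strict_linear_order_on X0 ?R"
    unfolding strict_linear_order_on_def
  proof (intro conjI)
    show "trans ?R" using R(1) by (auto intro!: transI dest: transD)
    show "irrefl ?R" using R(2) by (auto simp: irrefl_def)
    show "total_on X0 ?R" using R(3) gH ginj by (auto simp: total_on_def)
  qed
  moreover have "proper_coloring n (X0, E0) ?c"
    using c(1,2) g(2) gH E0 by (auto simp: Pi_iff)
  moreover have "\<forall>(x, y)\<in>?R. ?c x \<le> ?c y" using c(3) by auto
  ultimately have "(X0, E0, ?R, ?c) \<in> extensions n X"
    using X unfolding XE by (auto simp: monotone_ocgraphs_def)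
  moreover have "ocgraph_iso (X0, E0, ?R, ?c) (H, F, R, c)"
    using g gH by (auto intro!: exI[of _ g])
  ultimately show ?thesis by (simp only: ext_class_eq quotientI)
qed

text \<open>Two empty classes would be equal as well; membership in the quotient rules this out and
  supplies an extension isomorphic to both structures.\<close>

lemma ext_class_eqD:
  assumes "ext_class n X A = ext_class n X B"
    and "ext_class n X A \<in> extensions n X // iso_rel (extensions n X)"
  shows "ocgraph_iso A B"
proof -
  obtain e where "e \<in> ext_class n X A"
    using in_quotient_imp_non_empty[OF equiv_iso_rel assms(2)] by blast
  then have "ocgraph_iso e A" "ocgraph_iso e B" using assms(1) by (auto simp: ext_class_def)
  then show ?thesis using ocgraph_iso_sym ocgraph_iso_trans by blast
qed

text \<open>Bounds the number of colours by the number of types, with \<open>f\<close> the colour of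
  a copy and \<open>\<theta>\<close> its type.\<close>

lemma card_image_factor_le:
  assumes "finite (\<theta> ` A)" "\<And>x y. x \<in> A \<Longrightarrow> y \<in> A \<Longrightarrow> \<theta> x = \<theta> y \<Longrightarrow> f x = f y"
  shows "card (f ` A) \<le> card (\<theta> ` A)"
proof -
  have "f ` A \<subseteq> (\<lambda>t. f (SOME x. x \<in> A \<and> \<theta> x = t)) ` \<theta> ` A"
  proof
    fix z assume "z \<in> f ` A"
    then obtain x where x: "x \<in> A" "z = f x" by blast
    let ?y = "SOME y. y \<in> A \<and> \<theta> y = \<theta> x"
    have "?y \<in> A \<and> \<theta> ?y = \<theta> x" by (rule someI[of _ x]) (use x in simp)
    then have "f ?y = z" using assms(2)[of ?y x] x by simp
    then show "z \<in> (\<lambda>t. f (SOME x. x \<in> A \<and> \<theta> x = t)) ` \<theta> ` A" using x(1) by blast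
  qed
  then show ?thesis using surj_card_le[OF assms(1)] by blast
qed

lemma finite_quotient_extensions:
  assumes "finite_graph X"
  shows "finite (extensions n X // iso_rel (extensions n X))"
  using assms finite_extensions by (cases X) (auto intro!: finite_quotient simp: iso_rel_def)

lemma same_type_of_ocgraph_iso:
  assumes "ocgraph_iso (oc_induced (Y, F, rank_order Y r, c') H) (oc_induced (Y, F, rank_order Y r, c') H')"
    and "H \<subseteq> Y" "H' \<subseteq> Y" "\<And>y. y \<in> Y \<Longrightarrow> c' y = c y"
  shows "same_type F c r H H'"
proof -
  obtain g where g: "bij_betw g H H'"
    "\<forall>x\<in>H. \<forall>y\<in>H. (x, y) \<in> F \<inter> H \<times> H \<longleftrightarrow> (g x, g y) \<in> F \<inter> H' \<times> H'"
    "\<forall>x\<in>H. \<forall>y\<in>H. (x, y) \<in> rank_order Y r \<inter> H \<times> H \<longleftrightarrow> (g x, g y) \<in> rank_order Y r \<inter> H' \<times> H'"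
    "\<forall>x\<in>H. restrict c' H x = restrict c' H' (g x)"
    using assms(1) unfolding oc_induced.simps ocgraph_iso.simps by blast
  have gH: "g x \<in> H'" if "x \<in> H" for x using g(1) that by (auto simp: bij_betw_def)
  have "c (g x) = c x" if "x \<in> H" for x
  proof -
    have "c' x = c' (g x)" using g(4) that gH[OF that] by simp
    then show ?thesis using assms(2-4) that gH[OF that] by (metis subsetD)
  qed
  moreover have "r x < r y \<longleftrightarrow> r (g x) < r (g y)" if "x \<in> H" "y \<in> H" for x y
  proof -
    have "x \<in> Y" "y \<in> Y" "g x \<in> Y" "g y \<in> Y" using that gH assms(2,3) by auto
    then show ?thesis using g(3)[rule_format, OF that] that gH by (simp add: rank_order_def)
  qed
  moreover have "(x, y) \<in> F \<longleftrightarrow> (g x, g y) \<in> F" if "x \<in> H" "y \<in> H" for x y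
    using g(2)[rule_format, OF that] that gH by simp
  ultimately show ?thesis unfolding same_type_def using g(1) by blast
qed

lemma finite_inj_to_nat:
  assumes "finite A"
  obtains f :: "'a \<Rightarrow> nat" where "inj_on f A"
  using finite_imp_inj_to_nat_seg[OF assms] by blast

section \<open>The upper bound\<close>

lemma ramsey_bound_num_extensions:
  fixes X :: "'v::infinite graph"
  assumes X: "X \<in> colorable_graphs n"
  shows "ramsey_bound (colorable_graphs n) X (num_extensions n X)"
  unfolding ramsey_bound_def
proof (intro ballI allI)
  fix Y :: "'v graph" and k :: nat
  assume "Y \<in> colorable_graphs n"
  moreover obtain Y0 F where YF: "Y = (Y0, F)" by (cases Y)
  ultimately obtain c where G: "finite_graph (Y0, F)" and c: "proper_coloring n (Y0, F) c"
    unfolding colorable_graphs_def by blast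
  then have "finite Y0" by simp
  then obtain r0 :: "'v \<Rightarrow> nat" where r0: "inj_on r0 Y0" by (rule finite_inj_to_nat)
  \<comment> \<open>With the colour as leading key, every subset of \<open>Y0\<close> inherits a
    monotone structure.\<close>
  let ?r = "\<lambda>y. (c y, r0 y)"
  have r: "inj_on ?r Y0" using r0 by (auto simp: inj_on_def)
  have fX: "finite_graph X" using X by (simp add: colorable_graphs_def)
  obtain V :: "'v set" and E and pos :: "'v \<Rightarrow> nat" where VE: "(V, E) \<in> colorable_graphs n"
    and ram: "\<forall>\<chi>. (\<forall>U. \<chi> U \<in> {0..k}) \<longrightarrow> (\<exists>\<psi>. inj_on \<psi> Y0 \<and> \<psi> ` Y0 \<subseteq> V \<and>
       (\<forall>x\<in>Y0. \<forall>y\<in>Y0. (\<psi> x, \<psi> y) \<in> E \<longleftrightarrow> (x, y) \<in> F) \<and>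
       (\<forall>x\<in>Y0. \<forall>y\<in>Y0. ?r x < ?r y \<longrightarrow> pos (\<psi> x) < pos (\<psi> y)) \<and>
       (\<forall>H H'. H \<subseteq> Y0 \<and> H' \<subseteq> Y0 \<and> card H = card (fst X) \<and> same_type F c ?r H H' \<longrightarrow>
          \<chi> (\<psi> ` H) = \<chi> (\<psi> ` H')))"
    using canonical_ramsey[OF G c r, of "{0..k}" "card (fst X)"] by auto
  let ?Z = "(V, E)"
  have "arrows ?Z Y X k (num_extensions n X)"
    unfolding arrows_def
  proof
    fix \<alpha> assume \<alpha>: "\<alpha> \<in> copies ?Z X \<rightarrow> {1..k}"
    \<comment> \<open>Sets that induce no copy of \<open>X\<close> get the spare colour 0, hence the
      palette \<open>{0..k}\<close>.\<close>
    let ?\<chi> = "\<lambda>U. if induced ?Z U \<in> copies ?Z X then \<alpha> (induced ?Z U) else 0"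
    have "\<forall>U. ?\<chi> U \<in> {0..k}" using \<alpha> by (auto simp: Pi_iff)
    from ram[rule_format, of ?\<chi>, OF this[rule_format]]
    obtain \<psi> where \<psi>: "inj_on \<psi> Y0" "\<psi> ` Y0 \<subseteq> V"
      "\<forall>x\<in>Y0. \<forall>y\<in>Y0. (\<psi> x, \<psi> y) \<in> E \<longleftrightarrow> (x, y) \<in> F"
      and \<chi>: "\<forall>H H'. H \<subseteq> Y0 \<and> H' \<subseteq> Y0 \<and> card H = card (fst X) \<and> same_type F c ?r H H' \<longrightarrow>
          ?\<chi> (\<psi> ` H) = ?\<chi> (\<psi> ` H')" by (elim exE conjE)
    have emb: "graph_embedding Y ?Z \<psi>" using \<psi> unfolding graph_embedding_def YF by simp
    let ?Y = "induced ?Z (\<psi> ` Y0)"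
    have "induced Y Y0 = Y" using G unfolding YF induced_def by auto
    then have "graph_iso ?Y Y" using graph_iso_sym[OF graph_embedding_iso[OF emb, of Y0]] YF by simp
    then have copy: "?Y \<in> copies ?Z Y" using \<psi>(2) unfolding copies_iff fst_conv by blast
    let ?HH = "{H. H \<subseteq> Y0 \<and> graph_iso (induced Y H) X}"
    let ?A = "(Y0, F, rank_order Y0 ?r, restrict c Y0)"
    let ?\<theta> = "\<lambda>H. ext_class n X (oc_induced ?A H)"
    have A: "?A \<in> monotone_ocgraphs n" by (rule monotone_rank_order[OF G c r0])
    have \<theta>: "?\<theta> H \<in> extensions n X // iso_rel (extensions n X)" if "H \<in> ?HH" for H
    proof -
      have "H \<subseteq> Y0" "graph_iso (H, F \<inter> H \<times> H) X" using that by (auto simp: induced_def YF)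
      then show ?thesis
        using ext_class_in_quotient[OF _ _ fX] monotone_oc_induced[OF A, of H] by simp
    qed
    have eq: "?\<chi> (\<psi> ` H) = ?\<chi> (\<psi> ` H')" if "H \<in> ?HH" "H' \<in> ?HH" "?\<theta> H = ?\<theta> H'" for H H'
    proof -
      have "ocgraph_iso (oc_induced ?A H) (oc_induced ?A H')"
        using ext_class_eqD[OF that(3) \<theta>[OF that(1)]] .
      then have "same_type F c ?r H H'"
        by (rule same_type_of_ocgraph_iso) (use that in auto)
      moreover have "card H = card (fst X)" using that(1) graph_iso_card[of "induced Y H" X] by simp
      ultimately show ?thesis using \<chi>[rule_format, of H H'] that(1,2) by blast
    qed
    \<comment> \<open>Each copy of \<open>X\<close> inside the copy of \<open>Y\<close> is the image
      of some \<open>H\<close>, so its colour is one of those that factor through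
      \<open>?\<theta>\<close>.\<close>
    have "\<alpha> ` copies ?Y X \<subseteq> (\<lambda>H. ?\<chi> (\<psi> ` H)) ` ?HH"
    proof
      fix z assume "z \<in> \<alpha> ` copies ?Y X"
      then obtain S where S: "S \<subseteq> \<psi> ` Y0" "graph_iso (induced ?Z S) X" "z = \<alpha> (induced ?Z S)"
        unfolding copies_induced by blast
      obtain H where H: "H \<subseteq> Y0" "S = \<psi> ` H" using S(1) by (auto simp only: subset_image_iff)
      have "graph_iso (induced Y H) X"
        using graph_iso_trans[OF graph_embedding_iso[OF emb, of H]] H S(2) YF by simp
      moreover have "induced ?Z S \<in> copies ?Z X" 
        using S(1,2) \<psi>(2) unfolding copies_iff fst_conv by blast
      ultimately show "z \<in> (\<lambda>H. ?\<chi> (\<psi> ` H)) ` ?HH" using H S(3) by auto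
    qed
    moreover have fHH: "finite ?HH" using \<open>finite Y0\<close> by simp
    ultimately have "card (\<alpha> ` copies ?Y X) \<le> card ((\<lambda>H. ?\<chi> (\<psi> ` H)) ` ?HH)"
      by (intro card_mono) auto
    also have "\<dots> \<le> card (?\<theta> ` ?HH)"
      by (rule card_image_factor_le[OF finite_imageI[OF fHH] eq])
    also have "\<dots> \<le> num_extensions n X" unfolding num_extensions_def
      using \<theta> finite_quotient_extensions[OF fX] by (intro card_mono) blast+
    finally show "\<exists>Y'\<in>copies ?Z Y. card (\<alpha> ` copies Y' X) \<le> num_extensions n X" using copy by blast
  qed
  then show "\<exists>Z\<in>colorable_graphs n. arrows Z Y X k (num_extensions n X)" using VE by blast
qed

section \<open>The lower bound\<close>

lemma rank_of_strict_linear_order: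
  assumes "finite X" "strict_linear_order_on X R" "R \<subseteq> X \<times> X"
  shows "\<exists>rk :: 'a \<Rightarrow> nat. (\<forall>x\<in>X. rk x < card X) \<and>
    (\<forall>x\<in>X. \<forall>y\<in>X. (x, y) \<in> R \<longleftrightarrow> rk x < rk y) \<and> inj_on rk X"
proof -
  let ?rk = "\<lambda>x. card {z. (z, x) \<in> R}"
  have R: "trans R" "irrefl R" "total_on X R" using assms(2) by (auto simp: strict_linear_order_on_def)
  have fin: "finite {z. (z, x) \<in> R}" for x
    using assms(1,3) by (auto intro: finite_subset)
  have less: "?rk x < ?rk y" if "(x, y) \<in> R" for x y
  proof (intro psubset_card_mono fin psubsetI)
    show "{z. (z, x) \<in> R} \<subseteq> {z. (z, y) \<in> R}" using transD[OF R(1) _ that] by blast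
    have "(x, x) \<notin> R" using R(2) by (simp add: irrefl_def)
    then show "{z. (z, x) \<in> R} \<noteq> {z. (z, y) \<in> R}" using that by blast
  qed
  have total: "x = y \<or> (x, y) \<in> R \<or> (y, x) \<in> R" if "x \<in> X" "y \<in> X" for x y
    using R(3) that by (auto simp: total_on_def)
  show ?thesis
  proof (intro exI[of _ ?rk] conjI ballI)
    show "?rk x < card X" if "x \<in> X" for x
      using R(2) that assms by (intro psubset_card_mono) (auto simp: irrefl_def)
    show "(x, y) \<in> R \<longleftrightarrow> ?rk x < ?rk y" if "x \<in> X" "y \<in> X" for x y
      using total[OF that] less[of x y] less[of y x] by auto
    show "inj_on ?rk X"
    proof (rule inj_onI)
      fix x y assume "x \<in> X" "y \<in> X" "?rk x = ?rk y"
      then show "x = y" using total[of x y] less[of x y] less[of y x] by auto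
    qed
  qed
qed

text \<open>The witness for the lower bound: a complete \<open>n\<close>-partite block with three vertices in every
  class forces a colouring that is constant on pairs of each type to permute the colours, and the
  other blocks are the copies of \<open>X\<close> with every colouring and every ordering of each colour
  class, so that any permutation of the colours and any reversal of classes is undone in one of
  them.\<close>

definition block_index :: "nat \<Rightarrow> 'v graph \<Rightarrow> (('v \<Rightarrow> nat) \<times> ('v \<Rightarrow> nat)) set" where
  "block_index n X = {(d, s). d \<in> fst X \<rightarrow>\<^sub>E {1..n} \<and> proper_coloring n X d \<and>
     s \<in> fst X \<rightarrow>\<^sub>E {..<card (fst X)} \<and>
     (\<forall>x\<in>fst X. \<forall>y\<in>fst X. d x = d y \<and> s x = s y \<longrightarrow> x = y)}"

type_synonym 'v block_vertex = "nat \<times> nat + (('v \<Rightarrow> nat) \<times> ('v \<Rightarrow> nat)) \<times> 'v"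

definition block_vertices :: "nat \<Rightarrow> 'v graph \<Rightarrow> 'v block_vertex set" where
  "block_vertices n X = Inl ` ({1..n} \<times> {..<3}) \<union> Inr ` (block_index n X \<times> fst X)"

definition block_edges :: "nat \<Rightarrow> 'v graph \<Rightarrow> 'v block_vertex rel" where
  "block_edges n X =
     {(Inl (i, a), Inl (j, b)) | i a j b. i \<in> {1..n} \<and> j \<in> {1..n} \<and> a < 3 \<and> b < 3 \<and> i \<noteq> j} \<union>
     {(Inr (e, x), Inr (e, y)) | e x y. e \<in> block_index n X \<and> (x, y) \<in> snd X}"

fun block_col :: "'v block_vertex \<Rightarrow> nat" where
  "block_col (Inl (i, a)) = i"
| "block_col (Inr ((d, s), x)) = d x"

text \<open>The multipartite block comes first, so \<open>Inl (i, 0)\<close> precedes every other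
  vertex of colour \<open>i\<close>. Each further block is sorted by its colouring and then by
  \<open>s\<close>.\<close>

fun block_rank :: "(('v \<Rightarrow> nat) \<times> ('v \<Rightarrow> nat) \<Rightarrow> nat) \<Rightarrow> 'v block_vertex \<Rightarrow> nat \<times> nat \<times> nat" where
  "block_rank code (Inl (i, a)) = (0, i, a)"
| "block_rank code (Inr ((d, s), x)) = (Suc (code (d, s)), d x, s x)"

lemma finite_block_index:
  assumes "finite (fst X)"
  shows "finite (block_index n X)"
  by (rule finite_subset[of _ "(fst X \<rightarrow>\<^sub>E {1..n}) \<times> (fst X \<rightarrow>\<^sub>E {..<card (fst X)})"])
    (use assms in \<open>auto simp: block_index_def intro!: finite_PiE\<close>)

lemma block_graph:
  assumes X: "finite_graph X"
  shows "finite_graph (block_vertices n X, block_edges n X)"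
    "proper_coloring n (block_vertices n X, block_edges n X) block_col"
proof -
  obtain X0 E0 where XE: "X = (X0, E0)" by (cases X)
  have E: "finite X0" "E0 \<subseteq> X0 \<times> X0" "irrefl E0" "sym E0" using X XE by auto
  have "finite (block_vertices n X)"
    using finite_block_index[of X n] E(1) XE by (simp add: block_vertices_def)
  moreover have "block_edges n X \<subseteq> block_vertices n X \<times> block_vertices n X"
    using E(2) XE by (auto simp: block_edges_def block_vertices_def)
  moreover have "irrefl (block_edges n X)"
    using E(3) XE by (auto simp: block_edges_def irrefl_def)
  moreover have "sym (block_edges n X)"
    by (rule symI) (use E(4) XE in \<open>auto simp: block_edges_def dest: symD\<close>)
  ultimately show "finite_graph (block_vertices n X, block_edges n X)" by simp
  have "block_col \<in> block_vertices n X \<rightarrow> {1..n}"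
  proof
    fix w assume "w \<in> block_vertices n X"
    then show "block_col w \<in> {1..n}"
      by (auto simp: block_vertices_def block_index_def)
  qed
  moreover have "block_col u \<noteq> block_col v" if "(u, v) \<in> block_edges n X" for u v
    using that XE by (auto simp: block_edges_def block_index_def)
  ultimately show "proper_coloring n (block_vertices n X, block_edges n X) block_col" by auto
qed

lemma inj_on_block_rank:
  assumes "inj_on code (block_index n X)"
  shows "inj_on (block_rank code) (block_vertices n X)"
proof (rule inj_onI)
  fix u v assume uv: "u \<in> block_vertices n X" "v \<in> block_vertices n X"
    "block_rank code u = block_rank code v"
  show "u = v"
  proof (cases u)
    case (Inl p)
    then show ?thesis using uv by (cases p; cases v) auto
  next
    case (Inr p)
    then obtain d s x where u: "u = Inr ((d, s), x)" by (metis prod.collapse)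
    then obtain d' s' x' where v: "v = Inr ((d', s'), x')"
      using uv(3) by (cases v rule: block_col.cases) auto
    have i: "(d, s) \<in> block_index n X" "(d', s') \<in> block_index n X" "x \<in> fst X" "x' \<in> fst X"
      using uv(1,2) u v by (auto simp: block_vertices_def)
    have "(d', s') = (d, s)" using inj_onD[OF assms _ i(2,1)] uv(3) u v by simp
    then show ?thesis using uv(3) u v i by (auto simp: block_index_def)
  qed
qed

text \<open>Order and colours determine the type of a nonadjacent pair; in the witness this covers
  all pairs inside one colour class.\<close>

lemma same_type_pair:
  assumes "r u < r v" "r u' < r v'" "(u, v) \<notin> F" "(v, u) \<notin> F" "(u', v') \<notin> F" "(v', u') \<notin> F"
    and "\<And>w. (w, w) \<notin> F" "c u = c u'" "c v = c v'"
  shows "same_type F c r {u, v} {u', v'}"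
proof -
  have ne: "u \<noteq> v" "u' \<noteq> v'" using assms(1,2) by auto
  let ?g = "\<lambda>w. if w = u then u' else v'"
  have "bij_betw ?g {u, v} {u', v'}" using ne by (auto simp: bij_betw_def inj_on_def)
  moreover have "\<not> r v < r u" "\<not> r v' < r u'" using assms(1,2) by auto
  ultimately show ?thesis unfolding same_type_def using assms ne by (intro exI[of _ ?g]) auto
qed

text \<open>Pulling an ordered coloured structure back to the witness along an embedding that is
  constant on pairs of each type leaves only a permutation \<open>\<pi>\<close> of the colours and the
  reversal of some classes, recorded by \<open>\<rho>\<close>.\<close>

lemma block_embedding_extension:
  fixes \<Phi> :: "'v block_vertex \<Rightarrow> 'v"
  assumes e: "(X0, E0, R, c) \<in> monotone_ocgraphs n"
    and Z: "proper_coloring n (Z0, EZ) cZ" "inj_on (r0 :: 'v \<Rightarrow> nat) Z0"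
    and emb: "graph_embedding (block_vertices n (X0, E0), block_edges n (X0, E0)) (Z0, EZ) \<Phi>"
    and const: "\<And>u v u' v'. {u, v, u', v'} \<subseteq> block_vertices n (X0, E0) \<Longrightarrow>
       block_rank code u < block_rank code v \<Longrightarrow> block_rank code u' < block_rank code v' \<Longrightarrow>
       block_col u = block_col v \<Longrightarrow> block_col u' = block_col u \<Longrightarrow> block_col v' = block_col u \<Longrightarrow>
       cZ (\<Phi> u) = cZ (\<Phi> u') \<and> cZ (\<Phi> v) = cZ (\<Phi> v') \<and>
       ((cZ (\<Phi> u), r0 (\<Phi> u)) < (cZ (\<Phi> v), r0 (\<Phi> v)) \<longleftrightarrow>
        (cZ (\<Phi> u'), r0 (\<Phi> u')) < (cZ (\<Phi> v'), r0 (\<Phi> v')))"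
  shows "\<exists>S\<subseteq>\<Phi> ` block_vertices n (X0, E0).
     ocgraph_iso (X0, E0, R, c)
       (oc_induced (Z0, EZ, rank_order Z0 (\<lambda>z. (cZ z, r0 z)), restrict cZ Z0) S)"
proof -
  let ?W = "block_vertices n (X0, E0)" and ?F = "block_edges n (X0, E0)"
  let ?rZ = "\<lambda>z. (cZ z, r0 z)" and ?r = "block_rank code"
  have X: "finite X0" "E0 \<subseteq> X0 \<times> X0" and R: "strict_linear_order_on X0 R" "R \<subseteq> X0 \<times> X0"
    and c: "c \<in> X0 \<rightarrow> {1..n}" "\<And>x y. (x, y) \<in> E0 \<Longrightarrow> c x \<noteq> c y"
    and mono: "\<And>x y. (x, y) \<in> R \<Longrightarrow> c x \<le> c y"
    using e by (auto simp: monotone_ocgraphs_def)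
  have \<Phi>inj: "inj_on \<Phi> ?W" and \<Phi>Z: "\<And>w. w \<in> ?W \<Longrightarrow> \<Phi> w \<in> Z0"
    and \<Phi>E: "\<And>u v. u \<in> ?W \<Longrightarrow> v \<in> ?W \<Longrightarrow> (\<Phi> u, \<Phi> v) \<in> EZ \<longleftrightarrow> (u, v) \<in> ?F"
    using emb by (auto simp: graph_embedding_def)
  have cZ: "\<And>z. z \<in> Z0 \<Longrightarrow> cZ z \<in> {1..n}" "\<And>y z. (y, z) \<in> EZ \<Longrightarrow> cZ y \<noteq> cZ z" using Z(1) by auto
  define \<pi> where "\<pi> i = cZ (\<Phi> (Inl (i, 0)))" for i
  define \<rho> where "\<rho> i \<longleftrightarrow> ?rZ (\<Phi> (Inl (i, 0))) < ?rZ (\<Phi> (Inl (i, 1)))" for i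
  have InlW: "Inl (i, a) \<in> ?W" if "i \<in> {1..n}" "a < 3" for i a
    using that by (auto simp: block_vertices_def)
  have colW: "block_col w \<in> {1..n}" if "w \<in> ?W" for w
    using that by (auto simp: block_vertices_def block_index_def)
  \<comment> \<open>Here the third vertex matters: \<open>Inl (i, 1)\<close> is the upper end of one
    pair and the lower end of another, so both ends of a pair get the same colour.\<close>
  have \<pi>1: "cZ (\<Phi> (Inl (i, 1))) = \<pi> i" if i: "i \<in> {1..n}" for i
    using const[of "Inl (i, 0)" "Inl (i, 1)" "Inl (i, 1)" "Inl (i, 2)"] InlW[OF i]
    by (simp add: \<pi>_def)
  \<comment> \<open>As upper end of a pair that starts in \<open>Inl (i, 0)\<close>, the vertex
    \<open>w\<close> has the same colour as \<open>Inl (i, 1)\<close>.\<close>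
  have \<pi>: "cZ (\<Phi> w) = \<pi> (block_col w)" if w: "w \<in> ?W" for w
  proof (cases "w = Inl (block_col w, 0)")
    case True
    then show ?thesis unfolding \<pi>_def by simp
  next
    case False
    let ?i = "block_col w"
    have "?r (Inl (?i, 0)) < ?r w"
      using False by (cases w rule: block_col.cases) auto
    then have "cZ (\<Phi> (Inl (?i, 1))) = cZ (\<Phi> w)"
      using const[of "Inl (?i, 0)" "Inl (?i, 1)" "Inl (?i, 0)" w] InlW[OF colW[OF w]] w by simp
    then show ?thesis using \<pi>1[OF colW[OF w]] by simp
  qed
  have \<rho>: "?rZ (\<Phi> u) < ?rZ (\<Phi> v) \<longleftrightarrow> \<rho> (block_col u)"
    if uv: "u \<in> ?W" "v \<in> ?W" "?r u < ?r v" "block_col u = block_col v" for u v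
  proof -
    let ?i = "block_col u"
    have "?rZ (\<Phi> u) < ?rZ (\<Phi> v) \<longleftrightarrow> ?rZ (\<Phi> (Inl (?i, 0))) < ?rZ (\<Phi> (Inl (?i, 1)))"
      by (rule const[of u v "Inl (?i, 0)" "Inl (?i, 1)", THEN conjunct2, THEN conjunct2])
        (use InlW[OF colW[OF uv(1)]] uv in simp_all)
    then show ?thesis unfolding \<rho>_def .
  qed
  \<comment> \<open>Vertices of distinct colours in the multipartite block are adjacent, so their
    images differ in colour.\<close>
  have "inj_on \<pi> {1..n}"
  proof (rule inj_onI, rule ccontr)
    fix i j assume ij: "i \<in> {1..n}" "j \<in> {1..n}" "\<pi> i = \<pi> j" "i \<noteq> j"
    then have "(Inl (i, 0), Inl (j, 0)) \<in> ?F" by (auto simp: block_edges_def)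
    then show False using \<Phi>E[OF InlW[OF ij(1)] InlW[OF ij(2)]] cZ(2) ij(3) by (simp add: \<pi>_def)
  qed
  moreover have "\<pi> ` {1..n} \<subseteq> {1..n}" using cZ(1) \<Phi>Z InlW by (auto simp: \<pi>_def simp del: atLeastAtMost_iff)
  ultimately have \<pi>bij: "\<pi> ` {1..n} = {1..n}" by (intro endo_inj_surj) auto
  \<comment> \<open>The block to be used has the colouring that \<open>\<pi>\<close> turns into
    \<open>c\<close>.\<close>
  define d where "d = restrict (\<lambda>x. inv_into {1..n} \<pi> (c x)) X0"
  have d: "d x \<in> {1..n}" "\<pi> (d x) = c x" if "x \<in> X0" for x
  proof -
    have "c x \<in> \<pi> ` {1..n}" using c(1) that \<pi>bij by auto
    then show "d x \<in> {1..n}" "\<pi> (d x) = c x" unfolding d_def using that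
      by (simp_all only: restrict_apply if_True inv_into_into f_inv_into_f)
  qed
  obtain rk :: "'v \<Rightarrow> nat" where rk: "\<And>x. x \<in> X0 \<Longrightarrow> rk x < card X0"
    "\<And>x y. x \<in> X0 \<Longrightarrow> y \<in> X0 \<Longrightarrow> (x, y) \<in> R \<longleftrightarrow> rk x < rk y" "inj_on rk X0"
    using rank_of_strict_linear_order[OF X(1) R] by blast
  \<comment> \<open>Classes that \<open>\<Phi>\<close> reverses are listed backwards in advance;
    \<open>card X0 - Suc (rk x)\<close> is the reversed rank and stays below
    \<open>card X0\<close>.\<close>
  define s where "s = restrict (\<lambda>x. if \<rho> (d x) then rk x else card X0 - Suc (rk x)) X0"
  have s: "s x < card X0" if "x \<in> X0" for x
    using rk(1)[OF that] that by (auto simp: s_def)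
  have s_less: "s x < s y \<longleftrightarrow> (if \<rho> (d x) then rk x < rk y else rk y < rk x)"
    if "x \<in> X0" "y \<in> X0" "d x = d y" for x y
    using rk(1)[OF that(1)] rk(1)[OF that(2)] that by (auto simp: s_def)
  have "x = y" if "x \<in> X0" "y \<in> X0" "d x = d y" "s x = s y" for x y
  proof -
    have "rk x = rk y" using s_less[OF that(1-3)] s_less[OF that(2,1)] that(3,4)
      by (auto split: if_splits)
    then show ?thesis using inj_onD[OF rk(3)] that by blast
  qed
  moreover have "proper_coloring n (X0, E0) d"
    using d c(2) X(2) by (auto simp: subset_iff) metis
  moreover have "d \<in> extensional X0" "s \<in> extensional X0" unfolding d_def s_def by simp_all
  then have "d \<in> X0 \<rightarrow>\<^sub>E {1..n}" "s \<in> X0 \<rightarrow>\<^sub>E {..<card X0}"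
    using d(1) s by (auto simp: PiE_def)
  ultimately have ds: "(d, s) \<in> block_index n (X0, E0)"
    unfolding block_index_def fst_conv by blast
  let ?\<iota> = "\<lambda>x. Inr ((d, s), x) :: 'v block_vertex"
  let ?\<eta> = "\<lambda>x. \<Phi> (?\<iota> x)"
  have \<iota>W: "?\<iota> x \<in> ?W" if "x \<in> X0" for x using ds that by (simp add: block_vertices_def)
  have \<eta>Z: "?\<eta> x \<in> Z0" if "x \<in> X0" for x using \<Phi>Z[OF \<iota>W[OF that]] .
  have \<eta>inj: "?\<eta> x = ?\<eta> y \<longleftrightarrow> x = y" if "x \<in> X0" "y \<in> X0" for x y
    using inj_onD[OF \<Phi>inj _ \<iota>W[OF that(1)] \<iota>W[OF that(2)]] by auto
  have \<eta>c: "cZ (?\<eta> x) = c x" if "x \<in> X0" for x using \<pi>[OF \<iota>W[OF that]] d(2)[OF that] by simp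
  have \<eta>E: "(?\<eta> x, ?\<eta> y) \<in> EZ \<longleftrightarrow> (x, y) \<in> E0" if "x \<in> X0" "y \<in> X0" for x y
    using \<Phi>E[OF \<iota>W[OF that(1)] \<iota>W[OF that(2)]] ds by (simp add: block_edges_def)
  \<comment> \<open>Distinct colours settle the order by monotonicity on both sides; within one
    class \<open>s\<close> and \<open>\<rho>\<close> cancel.\<close>
  have imp: "?rZ (?\<eta> x) < ?rZ (?\<eta> y)" if xy: "x \<in> X0" "y \<in> X0" "(x, y) \<in> R" for x y
  proof (cases "c x = c y")
    case False
    then have "c x < c y" using mono[OF xy(3)] by simp
    then show ?thesis using \<eta>c xy by simp
  next
    case True
    then have deq: "d x = d y" using xy by (simp add: d_def)
    have rkl: "rk x < rk y" using rk(2) xy by simp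
    then have "x \<noteq> y" by auto
    show ?thesis
    proof (cases "\<rho> (d x)")
      case True
      then have "?r (?\<iota> x) < ?r (?\<iota> y)" using s_less[OF xy(1,2) deq] rkl deq by simp
      then show ?thesis using \<rho>[OF \<iota>W[OF xy(1)] \<iota>W[OF xy(2)]] True deq by simp
    next
      case False
      then have "?r (?\<iota> y) < ?r (?\<iota> x)" using s_less[OF xy(2,1) deq[symmetric]] rkl deq by simp
      then have "\<not> ?rZ (?\<eta> y) < ?rZ (?\<eta> x)"
        using \<rho>[OF \<iota>W[OF xy(2)] \<iota>W[OF xy(1)]] False deq by simp
      moreover have "?rZ (?\<eta> x) \<noteq> ?rZ (?\<eta> y)"
        using inj_onD[OF Z(2) _ \<eta>Z[OF xy(1)] \<eta>Z[OF xy(2)]] \<eta>inj[OF xy(1,2)] \<open>x \<noteq> y\<close> by blast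
      ultimately show ?thesis by (metis linorder_less_linear)
    qed
  qed
  have \<eta>R: "(x, y) \<in> R \<longleftrightarrow> ?rZ (?\<eta> x) < ?rZ (?\<eta> y)" if xy: "x \<in> X0" "y \<in> X0" for x y
  proof
    assume *: "?rZ (?\<eta> x) < ?rZ (?\<eta> y)"
    then have "x \<noteq> y" by auto
    then have "(x, y) \<in> R \<or> (y, x) \<in> R" using R(1) xy by (auto simp: strict_linear_order_on_def total_on_def)
    moreover have "(y, x) \<notin> R" using imp[OF xy(2,1)] * by (metis less_asym)
    ultimately show "(x, y) \<in> R" by blast
  qed (rule imp[OF xy])
  let ?S = "?\<eta> ` X0"
  have "bij_betw ?\<eta> X0 ?S" using \<eta>inj by (auto simp: bij_betw_def inj_on_def)
  moreover have "\<forall>x\<in>X0. \<forall>y\<in>X0. (x, y) \<in> E0 \<longleftrightarrow> (?\<eta> x, ?\<eta> y) \<in> EZ \<inter> ?S \<times> ?S" using \<eta>E by simp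
  moreover have "\<forall>x\<in>X0. \<forall>y\<in>X0. (x, y) \<in> R \<longleftrightarrow> (?\<eta> x, ?\<eta> y) \<in> rank_order Z0 ?rZ \<inter> ?S \<times> ?S"
    using \<eta>R \<eta>Z by (simp add: rank_order_def)
  moreover have "\<forall>x\<in>X0. c x = restrict (restrict cZ Z0) ?S (?\<eta> x)" using \<eta>c \<eta>Z by simp
  ultimately have "ocgraph_iso (X0, E0, R, c)
      (oc_induced (Z0, EZ, rank_order Z0 ?rZ, restrict cZ Z0) ?S)"
    unfolding oc_induced.simps ocgraph_iso.simps by blast
  moreover have "?S \<subseteq> \<Phi> ` ?W" using \<iota>W by blast
  ultimately show ?thesis by blast
qed

text \<open>In any copy of \<open>(V, E)\<close> inside \<open>Z\<close>, the colouring and order of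
  \<open>Z\<close> become uniform on some embedded block graph, which then realizes every extension
  of \<open>X\<close>. So all colours of the type colouring occur there.\<close>

lemma num_extensions_le:
  fixes X :: "'v::infinite graph"
  assumes X: "X \<in> colorable_graphs n" and t: "ramsey_bound (colorable_graphs n) X t"
  shows "num_extensions n X \<le> t"
proof -
  obtain X0 E0 where XE: "X = (X0, E0)" by (cases X)
  have fX: "finite_graph X" using X by (simp add: colorable_graphs_def)
  then have "finite (fst X)" by (cases X) simp
  then have "finite (block_index n X)" by (rule finite_block_index)
  then obtain code :: "('v \<Rightarrow> nat) \<times> ('v \<Rightarrow> nat) \<Rightarrow> nat" where code: "inj_on code (block_index n X)"
    by (rule finite_inj_to_nat)
  let ?W = "block_vertices n X" and ?F = "block_edges n X" and ?r = "block_rank code"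
  \<comment> \<open>A triple records the colours of the two ends of a pair in \<open>Z\<close> and
    whether \<open>Z\<close> orders them as \<open>pos\<close> does. Sets of triples are used
    because every vertex set needs a colour.\<close>
  let ?K = "Pow ({1..n} \<times> {1..n} \<times> (UNIV :: bool set))"
  have irr: "(w, w) \<notin> ?F" for w using block_graph(1)[OF fX, of n] by (simp add: irrefl_def)
  have nonadj: "(u, v) \<notin> ?F" if "block_col u = block_col v" for u v
    using block_graph(2)[OF fX, of n] that by auto
  have "finite ?K" by simp
  from canonical_ramsey[OF block_graph[OF fX] inj_on_block_rank[OF code] this, of 2]
  obtain V :: "'v set" and E and pos :: "'v \<Rightarrow> nat" where VE: "(V, E) \<in> colorable_graphs n"
    and ram: "\<forall>\<chi>. (\<forall>U. \<chi> U \<in> ?K) \<longrightarrow> (\<exists>\<psi>. inj_on \<psi> ?W \<and> \<psi> ` ?W \<subseteq> V \<and>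
       (\<forall>x\<in>?W. \<forall>y\<in>?W. (\<psi> x, \<psi> y) \<in> E \<longleftrightarrow> (x, y) \<in> ?F) \<and>
       (\<forall>x\<in>?W. \<forall>y\<in>?W. ?r x < ?r y \<longrightarrow> pos (\<psi> x) < pos (\<psi> y)) \<and>
       (\<forall>H H'. H \<subseteq> ?W \<and> H' \<subseteq> ?W \<and> card H = 2 \<and> same_type ?F block_col ?r H H' \<longrightarrow>
          \<chi> (\<psi> ` H) = \<chi> (\<psi> ` H')))"
    by (elim exE conjE)
  let ?quot = "extensions n X // iso_rel (extensions n X)"
  let ?\<tau> = "num_extensions n X"
  have "finite ?quot" by (rule finite_quotient_extensions[OF fX])
  then obtain h where h: "bij_betw h ?quot {1..?\<tau>}"
    unfolding num_extensions_def using ex_bij_betw_nat_finite_1 bij_betw_inv by blast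
  \<comment> \<open>\<open>(V, E)\<close> takes the role of \<open>Y\<close>, with one colour for
    each isomorphism type of extension.\<close>
  obtain Z where Z: "Z \<in> colorable_graphs n" and arr: "arrows Z (V, E) X ?\<tau> t"
    using t VE unfolding ramsey_bound_def by blast
  obtain Z0 EZ where ZE: "Z = (Z0, EZ)" by (cases Z)
  obtain cZ where fZ: "finite_graph (Z0, EZ)" and cZ: "proper_coloring n (Z0, EZ) cZ"
    using Z unfolding ZE colorable_graphs_def by blast
  have "finite Z0" using fZ by simp
  then obtain r0 :: "'v \<Rightarrow> nat" where r0: "inj_on r0 Z0" by (rule finite_inj_to_nat)
  let ?rZ = "\<lambda>z. (cZ z, r0 z)"
  let ?A = "(Z0, EZ, rank_order Z0 ?rZ, restrict cZ Z0)"
  have A: "?A \<in> monotone_ocgraphs n" by (rule monotone_rank_order[OF fZ cZ r0])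
  let ?\<alpha> = "\<lambda>H. h (ext_class n X (oc_induced ?A (fst H)))"
  have "?\<alpha> H \<in> {1..?\<tau>}" if H: "H \<in> copies Z X" for H
  proof -
    obtain S where S: "S \<subseteq> Z0" "H = induced Z S" "graph_iso (induced Z S) X"
      using H unfolding copies_iff ZE fst_conv by blast
    have "ext_class n X (oc_induced ?A S) \<in> ?quot"
      using ext_class_in_quotient[OF _ _ fX] monotone_oc_induced[OF A S(1)] S(3)
      by (simp add: induced_def ZE)
    then show ?thesis using bij_betwE[OF h] S(2) by simp
  qed
  then have \<alpha>: "?\<alpha> \<in> copies Z X \<rightarrow> {1..?\<tau>}" by blast
  then obtain Y' where Y': "Y' \<in> copies Z (V, E)" "card (?\<alpha> ` copies Y' X) \<le> t"
    using arr unfolding arrows_def by blast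
  obtain T where T: "T \<subseteq> Z0" "Y' = induced Z T" "graph_iso (V, E) (induced Z T)"
    using Y'(1) graph_iso_sym unfolding copies_iff ZE fst_conv by blast
  obtain g where g: "bij_betw g V T"
    "\<forall>x\<in>V. \<forall>y\<in>V. (x, y) \<in> E \<longleftrightarrow> (g x, g y) \<in> EZ \<inter> T \<times> T"
    using T(3) unfolding induced_def ZE snd_conv graph_iso.simps by blast
  have gT: "g x \<in> T" if "x \<in> V" for x using g(1) that by (auto simp: bij_betw_def)
  \<comment> \<open>The data of \<open>Z\<close> are pulled back along \<open>g\<close>. On the
    embedded witness \<open>pos\<close> agrees with \<open>block_rank\<close>, so a pair yields
    exactly one triple.\<close>
  let ?\<chi> = "\<lambda>U. {(cZ (g p), cZ (g q), ?rZ (g p) < ?rZ (g q)) | p q. p \<in> U \<inter> V \<and> q \<in> U \<inter> V \<and> pos p < pos q}"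
  have "?\<chi> U \<in> ?K" for U using cZ gT T(1) by (auto simp: Pi_iff subset_iff)
  from ram[rule_format, of ?\<chi>, OF this]
  obtain \<psi> where \<psi>: "inj_on \<psi> ?W" "\<psi> ` ?W \<subseteq> V"
    "\<forall>x\<in>?W. \<forall>y\<in>?W. (\<psi> x, \<psi> y) \<in> E \<longleftrightarrow> (x, y) \<in> ?F"
    "\<forall>x\<in>?W. \<forall>y\<in>?W. ?r x < ?r y \<longrightarrow> pos (\<psi> x) < pos (\<psi> y)"
    and \<chi>: "\<forall>H H'. H \<subseteq> ?W \<and> H' \<subseteq> ?W \<and> card H = 2 \<and> same_type ?F block_col ?r H H' \<longrightarrow>
          ?\<chi> (\<psi> ` H) = ?\<chi> (\<psi> ` H')" by (elim exE conjE)
  let ?\<Phi> = "\<lambda>w. g (\<psi> w)"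
  have \<psi>V: "\<psi> w \<in> V" if "w \<in> ?W" for w using \<psi>(2) that by blast
  have "inj_on ?\<Phi> ?W"
  proof (rule inj_onI)
    fix u v assume uv: "u \<in> ?W" "v \<in> ?W" "g (\<psi> u) = g (\<psi> v)"
    then have "\<psi> u = \<psi> v" using g(1) \<psi>V by (auto simp: bij_betw_def inj_on_def)
    then show "u = v" using \<psi>(1) uv by (auto simp: inj_on_def)
  qed
  moreover have \<Phi>T: "?\<Phi> ` ?W \<subseteq> T" using gT \<psi>V by blast
  moreover have "(?\<Phi> u, ?\<Phi> v) \<in> EZ \<longleftrightarrow> (u, v) \<in> ?F" if "u \<in> ?W" "v \<in> ?W" for u v
    using g(2) \<psi>(3) \<psi>V gT that by auto
  ultimately have emb: "graph_embedding (?W, ?F) (Z0, EZ) ?\<Phi>"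
    using T(1) unfolding graph_embedding_def by auto
  have \<chi>pair: "?\<chi> (\<psi> ` {u, v}) = {(cZ (?\<Phi> u), cZ (?\<Phi> v), ?rZ (?\<Phi> u) < ?rZ (?\<Phi> v))}"
    if "u \<in> ?W" "v \<in> ?W" "?r u < ?r v" for u v
  proof -
    have "pos (\<psi> u) < pos (\<psi> v)" using \<psi>(4) that by blast
    then show ?thesis using \<psi>V[OF that(1)] \<psi>V[OF that(2)] by (auto simp del: less_prod_simp)
  qed
  have const: "cZ (?\<Phi> u) = cZ (?\<Phi> u') \<and> cZ (?\<Phi> v) = cZ (?\<Phi> v') \<and>
      (?rZ (?\<Phi> u) < ?rZ (?\<Phi> v) \<longleftrightarrow> ?rZ (?\<Phi> u') < ?rZ (?\<Phi> v'))"
    if uv: "{u, v, u', v'} \<subseteq> ?W" "?r u < ?r v" "?r u' < ?r v'"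
      "block_col u = block_col v" "block_col u' = block_col u" "block_col v' = block_col u"
    for u v u' v'
  proof -
    have "same_type ?F block_col ?r {u, v} {u', v'}"
      using uv irr nonadj by (intro same_type_pair) auto
    moreover have "u \<noteq> v" using uv(2) by blast
    then have "card {u, v} = 2" by simp
    ultimately have "?\<chi> (\<psi> ` {u, v}) = ?\<chi> (\<psi> ` {u', v'})"
      using uv(1) by (intro \<chi>[rule_format]) auto
    moreover have W: "u \<in> ?W" "v \<in> ?W" "u' \<in> ?W" "v' \<in> ?W" using uv(1) by auto
    ultimately have "{(cZ (?\<Phi> u), cZ (?\<Phi> v), ?rZ (?\<Phi> u) < ?rZ (?\<Phi> v))} =
        {(cZ (?\<Phi> u'), cZ (?\<Phi> v'), ?rZ (?\<Phi> u') < ?rZ (?\<Phi> v'))}"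
      by (simp only: \<chi>pair[OF W(1,2) uv(2)] \<chi>pair[OF W(3,4) uv(3)])
    from singleton_inject[OF this] show ?thesis unfolding prod.inject .
  qed
  have "h q \<in> ?\<alpha> ` copies Y' X" if q: "q \<in> ?quot" for q
  proof -
    obtain e where e: "e \<in> extensions n X" "q = iso_rel (extensions n X) `` {e}"
      using q by (auto simp: quotient_def)
    then obtain R c where eRc: "e = (X0, E0, R, c)" "(X0, E0, R, c) \<in> monotone_ocgraphs n"
      unfolding XE by auto
    obtain S where S: "S \<subseteq> ?\<Phi> ` ?W" "ocgraph_iso e (oc_induced ?A S)"
      using block_embedding_extension[OF eRc(2) cZ r0, of ?\<Phi> code] emb const
      unfolding XE eRc(1) by blast
    have "graph_iso (induced Z S) X"
      using S(2) graph_iso_sym[of "(X0, E0)" "(S, EZ \<inter> S \<times> S)"] unfolding eRc(1) XE ZE induced_def by auto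
    then have "induced Z S \<in> copies Y' X"
      using S(1) \<Phi>T T(2) by (auto simp: copies_induced)
    moreover have "?\<alpha> (induced Z S) = h q"
      using ext_class_eq[OF e(1) S(2)] e(2) by simp
    ultimately show ?thesis by (metis (no_types, lifting) imageI)
  qed
  then have "h ` ?quot \<subseteq> ?\<alpha> ` copies Y' X" by blast
  then have sub: "{1..?\<tau>} \<subseteq> ?\<alpha> ` copies Y' X" using h by (simp add: bij_betw_def)
  have "copies Y' X \<subseteq> copies Z X"
  proof
    fix H assume "H \<in> copies Y' X"
    then obtain S where "S \<subseteq> T" "H = induced Z S" "graph_iso (induced Z S) X"
      unfolding T(2) copies_induced by blast
    then show "H \<in> copies Z X" using T(1) unfolding copies_iff ZE fst_conv by blast
  qed
  then have "?\<alpha> ` copies Y' X \<subseteq> {1..?\<tau>}" using \<alpha> by blast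
  then have "finite (?\<alpha> ` copies Y' X)" using finite_atLeastAtMost by (rule finite_subset)
  from card_mono[OF this sub] show ?thesis using Y'(2) by simp
qed

theorem theorem1p4:
  fixes n :: nat and X :: "'v::infinite graph"
  assumes "n \<ge> 1"
    and "X \<in> colorable_graphs n"
  shows "has_ramsey_degree (colorable_graphs n :: 'v graph set) X (num_extensions n X)"
  unfolding has_ramsey_degree_def
  using ramsey_bound_num_extensions[OF assms(2)] num_extensions_le[OF assms(2)] by blast

end
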